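(* Let $(M,\varphi,\xi,\eta,g)$ be an almost contact B-metric manifold and let $\dddot{T}$ be the torsion of its $\varphi$-canonical connection. Then $\dddot{T}$ belongs to $\mathcal{T}_3$ if and only if $(M,\varphi,\xi,\eta,g)$ belongs to $\mathcal{F}_3$, and $\dddot{T}$ belongs to $\mathcal{T}_7$ if and only if $(M,\varphi,\xi,\eta,g)$ belongs to $\mathcal{F}_7$.
   Context: An almost contact B-metric manifold $(M,\varphi,\xi,\eta,g)$ is a $(2n+1)$-dimensional smooth manifold with an endomorphism $\varphi$ of the tangent bundle, a vector field $\xi$, a 1-form $\eta$ and a pseudo-Riemannian metric $g$ of signature $(n,n+1)$ (so $g(\xi,\xi)=1$ and $g|_{\ker\eta}$ has signature $(n,n)$) such that $\varphi\xi=0$, $\varphi^2=-\mathrm{Id}+\eta\otimes\xi$, $\eta\circ\varphi=0$, $\eta(\xi)=1$, $g(\varphi X,\varphi Y)=-g(X,Y)+\eta(X)\eta(Y)$. $\nabla$ is the Levi-Civita connection of $g$, and $F(x,y,z)=g((\nabla_x\varphi)y,z)$. $\mathop{\mathfrak{S}}_{x,y,z}$ denotes the cyclic sum; $\{A(x,y,z)\}_{[x\leftrightarrow y]}=A(x,y,z)-A(y,x,z)$. $M\in\mathcal{F}_3$ means: $F(\xi,y,z)=F(x,\xi,z)=0$ and $\mathop{\mathfrak{S}}_{x,y,z}F(x,y,z)=0$. $M\in\mathcal{F}_7$ means: $F(x,y,z)=F(x,y,\xi)\eta(z)+F(x,z,\xi)\eta(y)$, $F(x,y,\xi)=-F(y,x,\xi)=-F(\varphi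 x,\varphi y,\xi)$, and $\theta=\theta^*=0$, where $\theta(z)=g^{ij}F(e_i,e_j,z)$, $\theta^*(z)=g^{ij}F(e_i,\varphi e_j,z)$, $\{e_i\}_{i=1}^{2n}$ a basis of $\ker\eta$, $(g^{ij})$ the inverse of $(g(e_i,e_j))$. The Nijenhuis tensor is $N(x,y)=\{(\nabla_{\varphi x}\varphi)y-\varphi(\nabla_x\varphi)y+(\nabla_x\eta)y\cdot\xi\}_{[x\leftrightarrow y]}$, $N(x,y,z)=g(N(x,y),z)$. A natural connection is a linear connection $D$ with $D\varphi=D\xi=D\eta=Dg=0$. Any metric connection $D$ is determined by its torsion $T(x,y,z)=g(D_xy-D_yx-[x,y],z)$ via $2g(D_xy-\nabla_xy,z)=T(x,y,z)-T(y,z,x)+T(z,x,y)$. The $\varphi$-canonical connection $\dddot{D}$ is the natural connection with torsion $\dddot{T}(x,y,z)=\dot T(x,y,z)-\frac18\{N(\varphi^2z,\varphi^2y,\varphi^2x)+2N(\varphi z,\varphi y,\xi)\eta(x)\}_{[x\leftrightarrow y]}$, where $\dot T(x,y,z)=\{-\frac12F(x,\varphi y,\varphi^2z)+\eta(x)F(y,\varphi z,\xi)+\eta(z)F(x,\varphi y,\xi)\}_{[x\leftrightarrow y]}$. (This torsion satisfies the identity $\{\dddot T(x,y,z)-\dddot T(x,\varphi y,\varphi z)-\eta(x)[\dddot T(\xi,y,z)-\dddot T(\xi,\varphi y,\varphi z)]-\eta(y)[\dddot T(x,\xi,z)-\dddot T(x,z,\xi)-\eta(x)\dddot T(z,\xi,\xi)]\}_{[y\leftrightarrow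 z]}=0$, by which the connection was introduced.) At each point, among $(0,3)$-tensors $T$ on $T_pM$ with $T(x,y,z)=-T(y,x,z)$: $\mathcal{T}_3$ consists of those with $T(\xi,y,z)=T(x,y,\xi)=0$ and $T(x,y,z)=-T(\varphi x,\varphi y,z)=T(\varphi x,y,\varphi z)$ for all $x,y,z$; $\mathcal{T}_7$ consists of those with $T(x,y,z)=\eta(z)T(\varphi^2x,\varphi^2y,\xi)$ and $T(x,y,\xi)=-T(\varphi x,\varphi y,\xi)$. A tensor field belongs to $\mathcal{T}_s$ if it does so at every point. *)

theory Defs
  imports "HOL-Analysis.Analysis" "HOL-Library.Function_Algebras"
begin

section \<open>Preliminaries\<close>

instantiation "fun" :: (type, real_vector) real_vector
begin

definition scaleR_fun_def: "a *\<^sub>R f = (\<lambda>x. a *\<^sub>R f x)"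

instance
  by standard (simp_all add: scaleR_fun_def fun_eq_iff scaleR_add_right scaleR_add_left)

end

definition linear_map_on :: "'a::real_vector set \<Rightarrow> ('a \<Rightarrow> 'b::real_vector) \<Rightarrow> bool" where
  "linear_map_on V f \<longleftrightarrow>
     (\<forall>u\<in>V. \<forall>v\<in>V. f (u + v) = f u + f v) \<and> (\<forall>a. \<forall>u\<in>V. f (a *\<^sub>R u) = a *\<^sub>R f u)"

definition is_basis :: "nat \<Rightarrow> (nat \<Rightarrow> 'a::real_vector) \<Rightarrow> 'a set \<Rightarrow> bool" where
  "is_basis k e V \<longleftrightarrow>
     inj_on e {..<k} \<and> independent (e ` {..<k}) \<and> span (e ` {..<k}) = V"

text \<open>Signature \<open>(r, s)\<close> means \<open>r\<close> negative and \<open>s\<close> positive directions; this is the order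
  in which \<open>(n, n + 1)\<close> is compatible with \<open>g(\<xi>, \<xi>) = 1\<close> and with signature \<open>(n, n)\<close>
  on the kernel of \<open>\<eta>\<close>.\<close>

definition has_signature ::
    "'a::real_vector set \<Rightarrow> ('a \<Rightarrow> 'a \<Rightarrow> real) \<Rightarrow> nat \<Rightarrow> nat \<Rightarrow> bool" where
  "has_signature V B r s \<longleftrightarrow>
     (\<exists>e. is_basis (r + s) e V \<and>
          (\<forall>i<r + s. \<forall>j<r + s. B (e i) (e j) = (if i \<noteq> j then 0 else if i < r then -1 else 1)))"

definition alternate :: "('a \<Rightarrow> 'a \<Rightarrow> 'b \<Rightarrow> 'c::minus) \<Rightarrow> 'a \<Rightarrow> 'a \<Rightarrow> 'b \<Rightarrow> 'c" where
  "alternate A x y z = A x y z - A y x z"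


section \<open>Smooth manifolds\<close>

text \<open>In finite dimension, \<open>C^k\<close> maps on an open set are those whose directional derivatives
  are all \<open>C^(k - 1)\<close>.\<close>

primrec Ck_on :: "nat \<Rightarrow> 'a::euclidean_space set \<Rightarrow> ('a \<Rightarrow> 'b::real_normed_vector) \<Rightarrow> bool" where
  "Ck_on 0 U f \<longleftrightarrow> continuous_on U f"
| "Ck_on (Suc k) U f \<longleftrightarrow>
     f differentiable_on U \<and> (\<forall>v. Ck_on k U (\<lambda>x. frechet_derivative f (at x) v))"

definition smooth_on :: "'a::euclidean_space set \<Rightarrow> ('a \<Rightarrow> 'b::real_normed_vector) \<Rightarrow> bool" where
  "smooth_on U f \<longleftrightarrow> (\<forall>k. Ck_on k U f)"

text \<open>The underlying space of the manifold is a whole type \<open>'m\<close>; its dimension is that of the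
  model space \<open>'e\<close>.\<close>

type_synonym ('m, 'e) chart = "'m set \<times> ('m \<Rightarrow> 'e)"

definition smooth_atlas :: "('m::topological_space, 'e::euclidean_space) chart set \<Rightarrow> bool" where
  "smooth_atlas A \<longleftrightarrow>
     (\<forall>(U, c)\<in>A. open U \<and> open (c ` U) \<and> homeomorphism U (c ` U) c (inv_into U c)) \<and>
     (\<Union>(U, c)\<in>A. U) = UNIV \<and>
     (\<forall>(U, c)\<in>A. \<forall>(V, d)\<in>A. smooth_on (c ` (U \<inter> V)) (d \<circ> inv_into U c))"

definition smooth_functions ::
    "('m::topological_space, 'e::euclidean_space) chart set \<Rightarrow> ('m \<Rightarrow> real) set" where
  "smooth_functions A = {f. \<forall>(U, c)\<in>A. smooth_on (c ` U) (f \<circ> inv_into U c)}"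

text \<open>Tangent vectors at \<open>p\<close> are the derivations at \<open>p\<close> of the algebra of smooth functions. As HOL
  functions are total, a derivation is set to \<open>0\<close> on non-smooth functions, so that it is
  determined by its values on smooth ones.\<close>

type_synonym 'm tvec = "('m \<Rightarrow> real) \<Rightarrow> real"
type_synonym 'm vfield = "'m \<Rightarrow> 'm tvec"

definition tangent_space ::
    "('m::topological_space, 'e::euclidean_space) chart set \<Rightarrow> 'm \<Rightarrow> 'm tvec set" where
  "tangent_space A p = {v.
     (\<forall>f. f \<notin> smooth_functions A \<longrightarrow> v f = 0) \<and>
     linear_map_on (smooth_functions A) v \<and>
     (\<forall>f\<in>smooth_functions A. \<forall>h\<in>smooth_functions A. v (f * h) = f p * v h + h p * v f)}"

definition vector_fields ::
    "('m::topological_space, 'e::euclidean_space) chart set \<Rightarrow> 'm vfield set" where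
  "vector_fields A = {X. (\<forall>p. X p \<in> tangent_space A p) \<and>
     (\<forall>f\<in>smooth_functions A. (\<lambda>p. X p f) \<in> smooth_functions A)}"

definition lie_bracket ::
    "('m::topological_space, 'e::euclidean_space) chart set \<Rightarrow> 'm vfield \<Rightarrow> 'm vfield \<Rightarrow> 'm vfield" where
  "lie_bracket A X Y = (\<lambda>p f. if f \<in> smooth_functions A
     then X p (\<lambda>q. Y q f) - Y p (\<lambda>q. X q f) else 0)"

text \<open>A smooth vector field with prescribed value \<open>v\<close> at \<open>p\<close>. It serves to evaluate at tangent
  vectors those expressions that are written with vector fields but depend only on
  their values at \<open>p\<close>.\<close>

definition extension ::
    "('m::topological_space, 'e::euclidean_space) chart set \<Rightarrow> 'm \<Rightarrow> 'm tvec \<Rightarrow> 'm vfield" where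
  "extension A p v = (SOME X. X \<in> vector_fields A \<and> X p = v)"

text \<open>\<open>D p u Y\<close> is the covariant derivative at \<open>p\<close> of the field \<open>Y\<close> in the direction of the
  tangent vector \<open>u\<close>.\<close>

type_synonym 'm connection = "'m \<Rightarrow> 'm tvec \<Rightarrow> 'm vfield \<Rightarrow> 'm tvec"

definition linear_connection ::
    "('m::topological_space, 'e::euclidean_space) chart set \<Rightarrow> 'm connection \<Rightarrow> bool" where
  "linear_connection A D \<longleftrightarrow>
     (\<forall>p. \<forall>u\<in>tangent_space A p. \<forall>Y\<in>vector_fields A. D p u Y \<in> tangent_space A p) \<and>
     (\<forall>X\<in>vector_fields A. \<forall>Y\<in>vector_fields A. (\<lambda>p. D p (X p) Y) \<in> vector_fields A) \<and>
     (\<forall>p. \<forall>Y\<in>vector_fields A. linear_map_on (tangent_space A p) (\<lambda>u. D p u Y)) \<and>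
     (\<forall>p. \<forall>u\<in>tangent_space A p. \<forall>Y\<in>vector_fields A. \<forall>Z\<in>vector_fields A.
        D p u (Y + Z) = D p u Y + D p u Z) \<and>
     (\<forall>p. \<forall>u\<in>tangent_space A p. \<forall>f\<in>smooth_functions A. \<forall>Y\<in>vector_fields A.
        D p u (\<lambda>q. f q *\<^sub>R Y q) = u f *\<^sub>R Y p + f p *\<^sub>R D p u Y)"

definition torsion_field ::
    "('m::topological_space, 'e::euclidean_space) chart set \<Rightarrow> 'm connection \<Rightarrow>
     'm vfield \<Rightarrow> 'm vfield \<Rightarrow> 'm vfield" where
  "torsion_field A D X Y p = D p (X p) Y - D p (Y p) X - lie_bracket A X Y p"


section \<open>Almost contact B-metric manifolds\<close>

record ('m, 'e) acbm =
  atlas :: "('m, 'e) chart set"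
  phi :: "'m \<Rightarrow> 'm tvec \<Rightarrow> 'm tvec"
  xi :: "'m vfield"
  eta :: "'m \<Rightarrow> 'm tvec \<Rightarrow> real"
  metric :: "'m \<Rightarrow> 'm tvec \<Rightarrow> 'm tvec \<Rightarrow> real"

abbreviation tangent ::
    "('m::topological_space, 'e::euclidean_space) acbm \<Rightarrow> 'm \<Rightarrow> 'm tvec set" where
  "tangent S p \<equiv> tangent_space (atlas S) p"

definition smooth_endomorphism_field ::
    "('m::topological_space, 'e::euclidean_space) chart set \<Rightarrow> ('m \<Rightarrow> 'm tvec \<Rightarrow> 'm tvec) \<Rightarrow> bool" where
  "smooth_endomorphism_field A \<phi> \<longleftrightarrow>
     (\<forall>p. linear_map_on (tangent_space A p) (\<phi> p) \<and> \<phi> p ` tangent_space A p \<subseteq> tangent_space A p) \<and>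
     (\<forall>X\<in>vector_fields A. (\<lambda>p. \<phi> p (X p)) \<in> vector_fields A)"

definition smooth_one_form ::
    "('m::topological_space, 'e::euclidean_space) chart set \<Rightarrow> ('m \<Rightarrow> 'm tvec \<Rightarrow> real) \<Rightarrow> bool" where
  "smooth_one_form A \<eta> \<longleftrightarrow>
     (\<forall>p. linear_map_on (tangent_space A p) (\<eta> p)) \<and>
     (\<forall>X\<in>vector_fields A. (\<lambda>p. \<eta> p (X p)) \<in> smooth_functions A)"

definition pseudo_riemannian_metric ::
    "nat \<Rightarrow> nat \<Rightarrow> ('m::topological_space, 'e::euclidean_space) chart set \<Rightarrow>
     ('m \<Rightarrow> 'm tvec \<Rightarrow> 'm tvec \<Rightarrow> real) \<Rightarrow> bool" where
  "pseudo_riemannian_metric r s A g \<longleftrightarrow>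
     (\<forall>p. (\<forall>u\<in>tangent_space A p. linear_map_on (tangent_space A p) (g p u)) \<and>
          (\<forall>u\<in>tangent_space A p. \<forall>v\<in>tangent_space A p. g p u v = g p v u) \<and>
          has_signature (tangent_space A p) (g p) r s) \<and>
     (\<forall>X\<in>vector_fields A. \<forall>Y\<in>vector_fields A. (\<lambda>p. g p (X p) (Y p)) \<in> smooth_functions A)"

definition almost_contact_B_metric_manifold ::
    "nat \<Rightarrow> ('m::{t2_space, second_countable_topology}, 'e::euclidean_space) acbm \<Rightarrow> bool" where
  "almost_contact_B_metric_manifold n S \<longleftrightarrow>
     DIM('e) = 2 * n + 1 \<and>
     smooth_atlas (atlas S) \<and>
     smooth_endomorphism_field (atlas S) (phi S) \<and>
     xi S \<in> vector_fields (atlas S) \<and>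
     smooth_one_form (atlas S) (eta S) \<and>
     pseudo_riemannian_metric n (n + 1) (atlas S) (metric S) \<and>
     (\<forall>p. phi S p (xi S p) = 0 \<and>
          eta S p (xi S p) = 1 \<and>
          (\<forall>x\<in>tangent S p.
             phi S p (phi S p x) = - x + eta S p x *\<^sub>R xi S p \<and>
             eta S p (phi S p x) = 0) \<and>
          (\<forall>x\<in>tangent S p. \<forall>y\<in>tangent S p.
             metric S p (phi S p x) (phi S p y) = - metric S p x y + eta S p x * eta S p y))"


section \<open>Connections and the tensors derived from them\<close>

definition metric_connection ::
    "('m::topological_space, 'e::euclidean_space) acbm \<Rightarrow> 'm connection \<Rightarrow> bool" where
  "metric_connection S D \<longleftrightarrow>
     linear_connection (atlas S) D \<and>
     (\<forall>p. \<forall>u\<in>tangent S p. \<forall>Y\<in>vector_fields (atlas S). \<forall>Z\<in>vector_fields (atlas S).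
        u (\<lambda>q. metric S q (Y q) (Z q)) = metric S p (D p u Y) (Z p) + metric S p (Y p) (D p u Z))"

definition levi_civita_connection ::
    "('m::topological_space, 'e::euclidean_space) acbm \<Rightarrow> 'm connection \<Rightarrow> bool" where
  "levi_civita_connection S D \<longleftrightarrow>
     metric_connection S D \<and>
     (\<forall>X\<in>vector_fields (atlas S). \<forall>Y\<in>vector_fields (atlas S). \<forall>p. torsion_field (atlas S) D X Y p = 0)"

text \<open>\<open>(D\<^sub>x \<phi>) y\<close> and \<open>(D\<^sub>x \<eta>) y\<close> at \<open>p\<close>.\<close>

definition cov_phi ::
    "('m::topological_space, 'e::euclidean_space) acbm \<Rightarrow> 'm connection \<Rightarrow>
     'm \<Rightarrow> 'm tvec \<Rightarrow> 'm tvec \<Rightarrow> 'm tvec" where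
  "cov_phi S D p x y = (let Y = extension (atlas S) p y
     in D p x (\<lambda>q. phi S q (Y q)) - phi S p (D p x Y))"

definition cov_eta ::
    "('m::topological_space, 'e::euclidean_space) acbm \<Rightarrow> 'm connection \<Rightarrow>
     'm \<Rightarrow> 'm tvec \<Rightarrow> 'm tvec \<Rightarrow> real" where
  "cov_eta S D p x y = (let Y = extension (atlas S) p y
     in x (\<lambda>q. eta S q (Y q)) - eta S p (D p x Y))"

definition torsion ::
    "('m::topological_space, 'e::euclidean_space) acbm \<Rightarrow> 'm connection \<Rightarrow>
     'm \<Rightarrow> 'm tvec \<Rightarrow> 'm tvec \<Rightarrow> 'm tvec \<Rightarrow> real" where
  "torsion S D p x y z = metric S p
     (torsion_field (atlas S) D (extension (atlas S) p x) (extension (atlas S) p y) p) z"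

definition natural_connection ::
    "('m::topological_space, 'e::euclidean_space) acbm \<Rightarrow> 'm connection \<Rightarrow> bool" where
  "natural_connection S D \<longleftrightarrow>
     metric_connection S D \<and>
     (\<forall>p. \<forall>x\<in>tangent S p. D p x (xi S) = 0 \<and>
        (\<forall>y\<in>tangent S p. cov_phi S D p x y = 0 \<and> cov_eta S D p x y = 0))"

text \<open>From here on \<open>LC\<close> is meant to be the Levi-Civita connection of the metric.\<close>

definition F_tensor ::
    "('m::topological_space, 'e::euclidean_space) acbm \<Rightarrow> 'm connection \<Rightarrow>
     'm \<Rightarrow> 'm tvec \<Rightarrow> 'm tvec \<Rightarrow> 'm tvec \<Rightarrow> real" where
  "F_tensor S LC p x y z = metric S p (cov_phi S LC p x y) z"

definition nijenhuis ::
    "('m::topological_space, 'e::euclidean_space) acbm \<Rightarrow> 'm connection \<Rightarrow>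
     'm \<Rightarrow> 'm tvec \<Rightarrow> 'm tvec \<Rightarrow> 'm tvec \<Rightarrow> real" where
  "nijenhuis S LC p x y z =
     (let N = (\<lambda>x y. cov_phi S LC p (phi S p x) y - phi S p (cov_phi S LC p x y)
                      + cov_eta S LC p x y *\<^sub>R xi S p)
      in metric S p (N x y - N y x) z)"

definition dot_torsion ::
    "('m::topological_space, 'e::euclidean_space) acbm \<Rightarrow> 'm connection \<Rightarrow>
     'm \<Rightarrow> 'm tvec \<Rightarrow> 'm tvec \<Rightarrow> 'm tvec \<Rightarrow> real" where
  "dot_torsion S LC p =
     (let F = F_tensor S LC p; \<phi> = phi S p; \<xi> = xi S p; \<eta> = eta S p
      in alternate (\<lambda>x y z. - (1/2) * F x (\<phi> y) (\<phi> (\<phi> z)) + \<eta> x * F y (\<phi> z) \<xi> + \<eta> z * F x (\<phi> y) \<xi>))"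

definition phi_canonical_connection ::
    "('m::topological_space, 'e::euclidean_space) acbm \<Rightarrow> 'm connection \<Rightarrow> 'm connection \<Rightarrow> bool" where
  "phi_canonical_connection S LC D \<longleftrightarrow>
     natural_connection S D \<and>
     (\<forall>p. \<forall>x\<in>tangent S p. \<forall>y\<in>tangent S p. \<forall>z\<in>tangent S p.
        let N = nijenhuis S LC p; \<phi> = phi S p; \<xi> = xi S p; \<eta> = eta S p
        in torsion S D p x y z = dot_torsion S LC p x y z
             - (1/8) * alternate (\<lambda>x y z. N (\<phi> (\<phi> z)) (\<phi> (\<phi> y)) (\<phi> (\<phi> x))
                                        + 2 * N (\<phi> z) (\<phi> y) \<xi> * \<eta> x) x y z)"


section \<open>The classes of manifolds and of torsion tensors\<close>

definition in_F3 ::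
    "('m::topological_space, 'e::euclidean_space) acbm \<Rightarrow> 'm connection \<Rightarrow> bool" where
  "in_F3 S LC \<longleftrightarrow>
     (\<forall>p. \<forall>x\<in>tangent S p. \<forall>y\<in>tangent S p. \<forall>z\<in>tangent S p.
        let F = F_tensor S LC p; \<xi> = xi S p
        in F \<xi> y z = 0 \<and> F x \<xi> z = 0 \<and> F x y z + F y z x + F z x y = 0)"

definition contact_kernel ::
    "('m::topological_space, 'e::euclidean_space) acbm \<Rightarrow> 'm \<Rightarrow> 'm tvec set" where
  "contact_kernel S p = {v \<in> tangent S p. eta S p v = 0}"

text \<open>\<open>h\<close> is the inverse \<open>(g\<^sup>i\<^sup>j)\<close> of the Gram matrix of \<open>e\<close>; both have size \<open>k\<close>.\<close>

definition inverse_gram ::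
    "nat \<Rightarrow> ('v \<Rightarrow> 'v \<Rightarrow> real) \<Rightarrow> (nat \<Rightarrow> 'v) \<Rightarrow> (nat \<Rightarrow> nat \<Rightarrow> real) \<Rightarrow> bool" where
  "inverse_gram k g e h \<longleftrightarrow> (\<forall>i<k. \<forall>j<k.
     (\<Sum>l<k. h i l * g (e l) (e j)) = (if i = j then 1 else 0) \<and>
     (\<Sum>l<k. g (e i) (e l) * h l j) = (if i = j then 1 else 0))"

text \<open>The traces \<open>\<theta>\<close> and \<open>\<theta>\<^sup>*\<close> do not depend on the basis of \<open>ker \<eta>\<close>; they are defined with
  respect to given \<open>e\<close> and \<open>h = (g\<^sup>i\<^sup>j)\<close>, and their vanishing is required for all bases.\<close>

definition theta ::
    "nat \<Rightarrow> ('m::topological_space, 'e::euclidean_space) acbm \<Rightarrow> 'm connection \<Rightarrow> 'm \<Rightarrow>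
     (nat \<Rightarrow> 'm tvec) \<Rightarrow> (nat \<Rightarrow> nat \<Rightarrow> real) \<Rightarrow> 'm tvec \<Rightarrow> real" where
  "theta n S LC p e h z = (\<Sum>i<2*n. \<Sum>j<2*n. h i j * F_tensor S LC p (e i) (e j) z)"

definition theta_star ::
    "nat \<Rightarrow> ('m::topological_space, 'e::euclidean_space) acbm \<Rightarrow> 'm connection \<Rightarrow> 'm \<Rightarrow>
     (nat \<Rightarrow> 'm tvec) \<Rightarrow> (nat \<Rightarrow> nat \<Rightarrow> real) \<Rightarrow> 'm tvec \<Rightarrow> real" where
  "theta_star n S LC p e h z = (\<Sum>i<2*n. \<Sum>j<2*n. h i j * F_tensor S LC p (e i) (phi S p (e j)) z)"

definition in_F7 ::
    "nat \<Rightarrow> ('m::topological_space, 'e::euclidean_space) acbm \<Rightarrow> 'm connection \<Rightarrow> bool" where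
  "in_F7 n S LC \<longleftrightarrow>
     (\<forall>p. \<forall>x\<in>tangent S p. \<forall>y\<in>tangent S p. \<forall>z\<in>tangent S p.
        let F = F_tensor S LC p; \<phi> = phi S p; \<xi> = xi S p; \<eta> = eta S p
        in F x y z = F x y \<xi> * \<eta> z + F x z \<xi> * \<eta> y \<and>
           F x y \<xi> = - F y x \<xi> \<and> F x y \<xi> = - F (\<phi> x) (\<phi> y) \<xi>) \<and>
     (\<forall>p e h. is_basis (2 * n) e (contact_kernel S p) \<and> inverse_gram (2 * n) (metric S p) e h \<longrightarrow>
        (\<forall>z\<in>tangent S p. theta n S LC p e h z = 0 \<and> theta_star n S LC p e h z = 0))"

definition torsion_tensors ::
    "'v::real_vector set \<Rightarrow> ('v \<Rightarrow> 'v \<Rightarrow> 'v \<Rightarrow> real) set" where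
  "torsion_tensors V = {T.
     (\<forall>y\<in>V. \<forall>z\<in>V. linear_map_on V (\<lambda>x. T x y z)) \<and>
     (\<forall>x\<in>V. \<forall>z\<in>V. linear_map_on V (\<lambda>y. T x y z)) \<and>
     (\<forall>x\<in>V. \<forall>y\<in>V. linear_map_on V (\<lambda>z. T x y z)) \<and>
     (\<forall>x\<in>V. \<forall>y\<in>V. \<forall>z\<in>V. T x y z = - T y x z)}"

definition T3_at ::
    "('m::topological_space, 'e::euclidean_space) acbm \<Rightarrow> 'm \<Rightarrow>
     ('m tvec \<Rightarrow> 'm tvec \<Rightarrow> 'm tvec \<Rightarrow> real) set" where
  "T3_at S p = {T \<in> torsion_tensors (tangent S p).
     \<forall>x\<in>tangent S p. \<forall>y\<in>tangent S p. \<forall>z\<in>tangent S p.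
       let \<phi> = phi S p; \<xi> = xi S p
       in T \<xi> y z = 0 \<and> T x y \<xi> = 0 \<and> T x y z = - T (\<phi> x) (\<phi> y) z \<and> T x y z = T (\<phi> x) y (\<phi> z)}"

definition T7_at ::
    "('m::topological_space, 'e::euclidean_space) acbm \<Rightarrow> 'm \<Rightarrow>
     ('m tvec \<Rightarrow> 'm tvec \<Rightarrow> 'm tvec \<Rightarrow> real) set" where
  "T7_at S p = {T \<in> torsion_tensors (tangent S p).
     \<forall>x\<in>tangent S p. \<forall>y\<in>tangent S p. \<forall>z\<in>tangent S p.
       let \<phi> = phi S p; \<xi> = xi S p; \<eta> = eta S p
       in T x y z = \<eta> z * T (\<phi> (\<phi> x)) (\<phi> (\<phi> y)) \<xi> \<and> T x y \<xi> = - T (\<phi> x) (\<phi> y) \<xi>}"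

end

theory Submission
  imports Defs
begin

text \<open>
  The statement is pointwise. The torsion formula expresses \<open>T\<close> linearly by \<open>F\<close> at the same
  point, and \<open>F\<close> can be recovered from \<open>T\<close>: the torsion of a metric connection \<open>D = \<nabla> + Q\<close>
  determines \<open>Q\<close>, and \<open>D \<phi> = 0\<close> means \<open>\<nabla> \<phi> = -[Q, \<phi>]\<close> (\<open>F_from_torsion\<close>). So only four
  computations remain. For \<open>F\<close> in the class \<open>\<F>\<^sub>3\<close> or \<open>\<F>\<^sub>7\<close> the torsion formula reduces to
  \<open>2 T(x, y, z) = F(x, \<phi> y, z) + F(y, \<phi> z, x) - F(z, \<phi> x, y)\<close> (\<open>T_of_F3\<close>) and to
  \<open>T(x, y, z) = 2 \<eta>(z) F(x, \<phi> y, \<xi>)\<close> (\<open>T_of_F7\<close>), from which membership in \<open>\<T>\<^sub>3\<close> and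
  \<open>\<T>\<^sub>7\<close> is read off; for \<open>T\<close> in \<open>\<T>\<^sub>3\<close> or \<open>\<T>\<^sub>7\<close> the inverse formula is equally
  short. The traces \<open>\<theta>\<close> and \<open>\<theta>\<^sup>*\<close> vanish because in \<open>\<F>\<^sub>7\<close> they contract skew forms.

  All this needs the symmetries of \<open>F\<close>: it is trilinear, symmetric in the last two arguments, and
  \<open>F(x, \<phi> y, \<phi> z) = F(x, y, z) - \<eta>(y) F(x, \<xi>, z) - \<eta>(z) F(x, y, \<xi>)\<close>. They come from
  differentiating the identities \<open>g(\<phi> Y, Z) = g(Y, \<phi> Z)\<close> and \<open>\<phi>\<^sup>2 Y = -Y + \<eta>(Y) \<xi>\<close>. The first one
  already shows that \<open>(\<nabla>\<^sub>x \<phi>) Y\<close> depends on \<open>Y\<close> at the point only (\<open>dphi_symmetric\<close>), provided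
  that every tangent vector is the value of a smooth vector field.

  That provision is where the analysis enters (\<open>vector_field_through\<close>). Tangent vectors are
  derivations of the algebra of global smooth functions, so bump functions are needed to transport
  coordinate derivatives to \<open>M\<close>. They yield a space of dimension \<open>dim M\<close> of derivations that extend
  to fields; by the signature of the metric the tangent space has no further room.
\<close>

section \<open>Linear algebra at a point\<close>

lemma linear_map_onD:
  assumes "subspace V" "linear_map_on V f"
  shows "x \<in> V \<Longrightarrow> y \<in> V \<Longrightarrow> f (x + y) = f x + f y"
    "x \<in> V \<Longrightarrow> f (a *\<^sub>R x) = a *\<^sub>R f x"
    "f 0 = 0"
    "x \<in> V \<Longrightarrow> f (- x) = - f x"
    "x \<in> V \<Longrightarrow> y \<in> V \<Longrightarrow> f (x - y) = f x - f y"
proof -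
  have scale: "f (a *\<^sub>R x) = a *\<^sub>R f x" if "x \<in> V" for a x
    using assms that by (auto simp: linear_map_on_def)
  show "x \<in> V \<Longrightarrow> y \<in> V \<Longrightarrow> f (x + y) = f x + f y" "x \<in> V \<Longrightarrow> f (a *\<^sub>R x) = a *\<^sub>R f x"
    using assms by (auto simp: linear_map_on_def)
  show "f 0 = 0" using scale[of 0 0] subspace_0[OF assms(1)] by simp
  show minus: "f (- x) = - f x" if "x \<in> V" for x using scale[OF that, of "-1"] by simp
  show "f (x - y) = f x - f y" if "x \<in> V" "y \<in> V"
    using assms that minus[of y]
    by (simp add: linear_map_on_def subspace_neg flip: add_uminus_conv_diff)
qed

text \<open>The situation at a point: \<open>V\<close> is the tangent space and \<open>F\<close> has the symmetries of
  \<open>F(x, y, z) = g((\<nabla>\<^sub>x \<phi>) y, z)\<close>. The metric occurs in neither torsion nor classes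
  once they are written with \<open>F\<close>, except through the traces, which are treated in
  \<open>F7_traces\<close>. Linear maps and tensors carry information on \<open>V\<close> only, hence the
  relativisation.\<close>

locale acb_tensor =
  fixes V :: "'v::real_vector set" and phi :: "'v \<Rightarrow> 'v" and xi :: 'v and eta :: "'v \<Rightarrow> real"
    and F :: "'v \<Rightarrow> 'v \<Rightarrow> 'v \<Rightarrow> real"
  assumes V: "subspace V"
    and xi: "xi \<in> V"
    and phi_in: "x \<in> V \<Longrightarrow> phi x \<in> V"
    and phi_linear: "linear_map_on V phi"
    and eta_linear: "linear_map_on V eta"
    and phi_xi: "phi xi = 0"
    and eta_xi: "eta xi = 1"
    and phi_phi: "x \<in> V \<Longrightarrow> phi (phi x) = - x + eta x *\<^sub>R xi"
    and eta_phi: "x \<in> V \<Longrightarrow> eta (phi x) = 0"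
    and F_linear1: "y \<in> V \<Longrightarrow> z \<in> V \<Longrightarrow> linear_map_on V (\<lambda>x. F x y z)"
    and F_linear3: "x \<in> V \<Longrightarrow> y \<in> V \<Longrightarrow> linear_map_on V (\<lambda>z. F x y z)"
    and F_sym: "x \<in> V \<Longrightarrow> y \<in> V \<Longrightarrow> z \<in> V \<Longrightarrow> F x y z = F x z y"
    and F_phi_phi: "x \<in> V \<Longrightarrow> y \<in> V \<Longrightarrow> z \<in> V \<Longrightarrow>
      F x (phi y) (phi z) = F x y z - eta y * F x xi z - eta z * F x y xi"
begin

text \<open>The Nijenhuis tensor in terms of \<open>F\<close>: \<open>(\<nabla>\<^sub>x \<eta>) y\<close> has been replaced by
  \<open>F(x, \<phi> y, \<xi>)\<close>, which equals it on every manifold (lemma \<open>cov_eta_F\<close> below).\<close>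

definition N where
  "N x y z = F (phi x) y z - F x y (phi z) + F x (phi y) xi * eta z
           - (F (phi y) x z - F y x (phi z) + F y (phi x) xi * eta z)"

text \<open>The torsion of the \<open>\<phi>\<close>-canonical connection.\<close>

definition T where
  "T = (\<lambda>x y z. alternate (\<lambda>x y z. - (1/2) * F x (phi y) (phi (phi z))
                       + eta x * F y (phi z) xi + eta z * F x (phi y) xi) x y z
     - (1/8) * alternate (\<lambda>x y z. N (phi (phi z)) (phi (phi y)) (phi (phi x))
                                  + 2 * N (phi z) (phi y) xi * eta x) x y z)"

lemma V_closed [simp]:
  "xi \<in> V" "x \<in> V \<Longrightarrow> phi x \<in> V" "0 \<in> V" "x \<in> V \<Longrightarrow> - x \<in> V" "x \<in> V \<Longrightarrow> a *\<^sub>R x \<in> V"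
  "x \<in> V \<Longrightarrow> y \<in> V \<Longrightarrow> x + y \<in> V" "x \<in> V \<Longrightarrow> y \<in> V \<Longrightarrow> x - y \<in> V"
  using xi phi_in V by (auto simp: subspace_def subspace_neg subspace_diff)

lemmas linear_on_V = linear_map_onD[OF V]

lemmas F_arg1 [simp] = linear_on_V[OF F_linear1]
lemmas F_arg3 [simp] = linear_on_V[OF F_linear3]

lemma F_linear2: "x \<in> V \<Longrightarrow> z \<in> V \<Longrightarrow> linear_map_on V (\<lambda>y. F x y z)"
  using F_sym by (auto simp: linear_map_on_def)

lemmas F_arg2 [simp] = linear_on_V[OF F_linear2]

lemmas phi_eval [simp] = phi_xi phi_phi eta_xi eta_phi linear_on_V[OF phi_linear] linear_on_V[OF eta_linear]

lemma F_xi_xi [simp]: "x \<in> V \<Longrightarrow> F x xi xi = 0"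
  using F_phi_phi[of x xi xi] by simp

lemma F_xi2: "x \<in> V \<Longrightarrow> z \<in> V \<Longrightarrow> F x xi z = F x z xi"
  using F_sym by simp

text \<open>Up to terms that vanish on the kernel of \<open>\<eta>\<close>, \<open>F(x, \<phi> y, z)\<close> is skew in \<open>y, z\<close>. As a rewrite
  rule for given vectors this collects \<open>\<phi>\<close> in the third argument.\<close>

lemma F_phi_swap:
  "x \<in> V \<Longrightarrow> y \<in> V \<Longrightarrow> z \<in> V \<Longrightarrow>
    F x (phi y) z = - F x y (phi z) + eta y * F x (phi z) xi + eta z * F x (phi y) xi"
  using F_phi_phi[of x y "phi z"] F_xi2[of x "phi z"] by simp

text \<open>The torsion determines \<open>F\<close>. The potential \<open>Q\<close> of a metric connection \<open>D = \<nabla> + Q\<close> is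
  \<open>2 Q(x, y, z) = T(x, y, z) - T(y, z, x) + T(z, x, y)\<close>, and \<open>D \<phi> = 0\<close> reads
  \<open>F(x, y, z) = Q(x, y, \<phi> z) - Q(x, \<phi> y, z)\<close>; this is the identity that results. It is
  checked here on the formula for \<open>T\<close> by reduction to normal form.\<close>

lemma F_from_torsion:
  assumes [simp]: "x \<in> V" "y \<in> V" "z \<in> V"
  shows "2 * F x y z = T x y (phi z) - T y (phi z) x + T (phi z) x y
           - T x (phi y) z + T (phi y) z x - T z x (phi y)"
proof -
  (* The last two arguments are put into the order x, y, z, xi and phi is moved to the later one.
     Only instances oriented in this way are given, because the general equations would loop. *)
  note oriented = F_sym[of _ z y] F_sym[of _ z x] F_sym[of _ y x]
    F_sym[of _ xi x] F_sym[of _ xi y] F_sym[of _ xi z]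
    F_sym[of _ xi "phi x"] F_sym[of _ xi "phi y"] F_sym[of _ xi "phi z"]
    F_sym[of _ "phi z" y] F_sym[of _ "phi z" x] F_sym[of _ "phi y" x]
    F_sym[of _ z "phi y"] F_sym[of _ z "phi x"] F_sym[of _ y "phi x"]
    F_phi_swap[of _ y z] F_phi_swap[of _ x z] F_phi_swap[of _ x y]
  show ?thesis unfolding T_def alternate_def N_def
    by (simp add: oriented F_phi_phi field_simps)
qed

lemma T_torsion: "T \<in> torsion_tensors V"
  unfolding torsion_tensors_def linear_map_on_def T_def alternate_def N_def
  by (simp add: field_simps)

lemma T_skew: "x \<in> V \<Longrightarrow> y \<in> V \<Longrightarrow> z \<in> V \<Longrightarrow> T x y z = - T y x z"
  using T_torsion unfolding torsion_tensors_def by blast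

lemma
  shows T_arg1: "y \<in> V \<Longrightarrow> z \<in> V \<Longrightarrow> linear_map_on V (\<lambda>x. T x y z)"
    and T_arg2: "x \<in> V \<Longrightarrow> z \<in> V \<Longrightarrow> linear_map_on V (\<lambda>y. T x y z)"
    and T_arg3: "x \<in> V \<Longrightarrow> y \<in> V \<Longrightarrow> linear_map_on V (\<lambda>z. T x y z)"
  using T_torsion unfolding torsion_tensors_def by blast+

lemmas T_lin [simp] = linear_on_V[OF T_arg1] linear_on_V[OF T_arg2] linear_on_V[OF T_arg3]

text \<open>The defining conditions of the classes at a point; those on the traces of \<open>F\<close> are the
  subject of \<open>F7_traces\<close>.\<close>

definition F3 where "F3 \<longleftrightarrow> (\<forall>x\<in>V. \<forall>y\<in>V. \<forall>z\<in>V.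
   F xi y z = 0 \<and> F x xi z = 0 \<and> F x y z + F y z x + F z x y = 0)"

definition T3 where "T3 \<longleftrightarrow> (\<forall>x\<in>V. \<forall>y\<in>V. \<forall>z\<in>V.
   T xi y z = 0 \<and> T x y xi = 0 \<and> T x y z = - T (phi x) (phi y) z \<and> T x y z = T (phi x) y (phi z))"

definition F7 where "F7 \<longleftrightarrow> (\<forall>x\<in>V. \<forall>y\<in>V. \<forall>z\<in>V.
   F x y z = F x y xi * eta z + F x z xi * eta y \<and>
   F x y xi = - F y x xi \<and> F x y xi = - F (phi x) (phi y) xi)"

definition T7 where "T7 \<longleftrightarrow> (\<forall>x\<in>V. \<forall>y\<in>V. \<forall>z\<in>V.
   T x y z = eta z * T (phi (phi x)) (phi (phi y)) xi \<and> T x y xi = - T (phi x) (phi y) xi)"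

lemma F3_xi:
  assumes F3 "a \<in> V" "b \<in> V"
  shows "F xi a b = 0" "F a xi b = 0" "F a b xi = 0"
  using assms F_sym[of a b xi] by (auto simp: F3_def)

lemma F3_cyclic:
  assumes F3 "a \<in> V" "b \<in> V" "c \<in> V"
  shows "F (phi a) b c = - F b c (phi a) - F c (phi a) b"
proof -
  have "F (phi a) b c + F b c (phi a) + F c (phi a) b = 0"
    using assms unfolding F3_def by (meson phi_in)
  then show ?thesis by simp
qed

lemma F3_phi_swap:
  assumes F3 "a \<in> V" "b \<in> V" "c \<in> V"
  shows "F a (phi b) c = - F a b (phi c)" "F a b (phi c) = - F a c (phi b)"
  using F_phi_swap[of a b c] F_sym[of a "phi b" c] assms by (simp_all add: F3_xi)

text \<open>In \<open>F3\<close> everything can be expressed by \<open>G(a; b, c) = F(a, \<phi> b, c)\<close>, skew in \<open>b, c\<close>. The cyclic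
  identity removes the terms with \<open>\<phi>\<close> in the first argument, which leaves
  \<open>2 T(x, y, z) = G(x; y, z) + G(y; z, x) - G(z; x, y)\<close>.\<close>

lemma T_of_F3:
  assumes F3 and [simp]: "x \<in> V" "y \<in> V" "z \<in> V"
  shows "2 * T x y z = F x (phi y) z + F y (phi z) x - F z (phi x) y"
  unfolding T_def alternate_def N_def
  (* The cyclic identity enters only through three instances: as a general rewrite rule it would loop. *)
  using F3_cyclic[OF assms(1), of x y z] F3_cyclic[OF assms(1), of y z x]
    F3_cyclic[OF assms(1), of z x y] F3_phi_swap(2)[OF assms(1), of y x z]
    F3_phi_swap(2)[OF assms(1), of z y x] F3_phi_swap(2)[OF assms(1), of x z y]
  by (simp add: F3_xi[OF assms(1)] F_phi_phi F3_phi_swap(1)[OF assms(1)]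
      F_sym[of _ z y] F_sym[of _ z x] F_sym[of _ y x] field_simps)

lemma F3_imp_T3:
  assumes F3 shows T3
  unfolding T3_def
proof (intro ballI conjI)
  fix x y z assume [simp]: "x \<in> V" "y \<in> V" "z \<in> V"
  note T = T_of_F3[OF assms] and xi0 [simp] = F3_xi[OF assms]
  note cyclic = F3_cyclic[OF assms, of x y z] F3_cyclic[OF assms, of y z x]
    F3_cyclic[OF assms, of z x y]
  note swap = F3_phi_swap(1)[OF assms] and skew = F3_phi_swap(2)[OF assms, of y x z]
    F3_phi_swap(2)[OF assms, of z y x] F3_phi_swap(2)[OF assms, of x z y]
  show "T xi y z = 0" "T x y xi = 0" using T[of xi y z] T[of x y xi] by simp_all
  show "T x y z = - T (phi x) (phi y) z" "T x y z = T (phi x) y (phi z)"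
    using T[of x y z] T[of "phi x" "phi y" z] T[of "phi x" y "phi z"] cyclic skew
    by (simp_all add: F_phi_phi swap F_sym[of _ z y] F_sym[of _ z x] F_sym[of _ y x])
qed

text \<open>In \<open>T3\<close> moving \<open>\<phi>\<close> between any two arguments of \<open>T\<close> changes at most the sign, so that
  \<open>F_from_torsion\<close> collapses to \<open>F(x, y, z) = T(x, y, \<phi> z) - T(z, x, \<phi> y)\<close>, whose
  cyclic sum telescopes.\<close>

lemma T3_imp_F3:
  assumes T3 shows F3
proof -
  have T0: "T xi a b = 0" "T a xi b = 0" "T a b xi = 0" if "a \<in> V" "b \<in> V" for a b
  proof -
    show T0: "T xi a b = 0" "T a b xi = 0" using assms that unfolding T3_def by blast+
    show "T a xi b = 0" using T0 T_skew[of a xi b] that by simp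
  qed
  have T1: "T (phi a) b c = - T a b (phi c)" "T a (phi b) c = - T a b (phi c)"
    if [simp]: "a \<in> V" "b \<in> V" "c \<in> V" for a b c
  proof -
    have "T a b (phi c) = T (phi a) b (phi (phi c))" "T a (phi b) c = - T (phi a) (phi (phi b)) c"
      using assms that phi_in unfolding T3_def by meson+
    then show "T (phi a) b c = - T a b (phi c)" "T a (phi b) c = - T a b (phi c)"
      by (simp_all add: T0)
  qed
  have "F x y z = T x y (phi z) - T z x (phi y)" if "x \<in> V" "y \<in> V" "z \<in> V" for x y z
    using F_from_torsion[of x y z] that by (simp add: T1)
  then show ?thesis by (simp add: F3_def T0)
qed

lemma F7_expand:
  assumes F7 "a \<in> V" "b \<in> V" "c \<in> V"
  shows "F a b c = F a b xi * eta c + F a c xi * eta b"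
  using assms unfolding F7_def by blast

lemma F7_skew:
  assumes F7 "a \<in> V" "b \<in> V"
  shows "F a b xi = - F b a xi" "F (phi a) (phi b) xi = - F a b xi"
  using assms xi unfolding F7_def by (metis minus_minus)+

lemma F7_xi: "F7 \<Longrightarrow> a \<in> V \<Longrightarrow> F xi a xi = 0"
  using F7_skew(1)[of xi a] by simp

lemma F7_phi_swap:
  assumes F7 "a \<in> V" "b \<in> V" shows "F (phi a) b xi = F a (phi b) xi"
  using F7_skew(2)[of a "phi b"] F7_skew(1)[of "phi a" xi] assms by (simp add: F7_xi)

text \<open>In \<open>F7\<close> the horizontal part of \<open>N\<close> vanishes and \<open>N(\<phi> z, \<phi> y, \<xi>) = -4 F(z, \<phi> y, \<xi>)\<close>;
  the latter cancels the terms of the torsion that carry \<open>\<eta>(x)\<close> or \<open>\<eta>(y)\<close>.\<close>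

lemma T_of_F7:
  assumes F7 and [simp]: "x \<in> V" "y \<in> V" "z \<in> V"
  shows "T x y z = 2 * eta z * F x (phi y) xi"
proof -
  note F = F7_expand[OF assms(1)] and skew = F7_skew(1)[OF assms(1)]
    and swap = F7_phi_swap[OF assms(1)] and xi0 [simp] = F7_xi[OF assms(1)]
  have N1: "N (phi (phi a)) (phi (phi b)) (phi (phi c)) = 0" if "a \<in> V" "b \<in> V" "c \<in> V" for a b c
    unfolding N_def using that
      F[of "phi (phi (phi a))" "phi (phi b)" "phi (phi c)"]
      F[of "phi (phi a)" "phi (phi b)" "phi (phi (phi c))"]
      F[of "phi (phi (phi b))" "phi (phi a)" "phi (phi c)"]
      F[of "phi (phi b)" "phi (phi a)" "phi (phi (phi c))"]
    by (simp del: phi_phi)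
  have N2: "N (phi a) (phi b) xi = - 4 * F a (phi b) xi" if "a \<in> V" "b \<in> V" for a b
    unfolding N_def using that skew[of b "phi a"] skew[of "phi b" a] by (simp add: swap)
  have F0: "F a (phi b) (phi (phi c)) = 0" if "a \<in> V" "b \<in> V" "c \<in> V" for a b c
    using F[of a "phi b" "phi (phi c)"] that by (simp del: phi_phi)
  show ?thesis unfolding T_def alternate_def
    using skew[of y "phi x"] skew[of z "phi x"] skew[of z "phi y"]
    by (simp add: N1 N2 F0 swap del: phi_phi) (simp add: swap field_simps)
qed

lemma F7_imp_T7:
  assumes F7 shows T7
  unfolding T7_def
proof (intro ballI conjI)
  fix x y z assume [simp]: "x \<in> V" "y \<in> V" "z \<in> V"
  note T = T_of_F7[OF assms] and invariant = F7_skew(2)[OF assms]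
  show "T x y z = eta z * T (phi (phi x)) (phi (phi y)) xi"
    using T[of x y z] T[of "phi (phi x)" "phi (phi y)" xi]
      invariant[of "phi x" "phi (phi y)"] invariant[of x "phi y"] by (simp del: phi_phi)
  show "T x y xi = - T (phi x) (phi y) xi"
    using T[of x y xi] T[of "phi x" "phi y" xi] invariant[of x "phi y"] by simp
qed

text \<open>In \<open>T7\<close> only the terms of \<open>F_from_torsion\<close> with a \<open>\<xi>\<close>-component in the last argument of
  \<open>T\<close> survive, and \<open>T(\<phi> x, y, \<xi>) = T(x, \<phi> y, \<xi>)\<close> cancels those with \<open>\<eta>(x)\<close>.\<close>

lemma T7_imp_F7:
  assumes T7 shows F7
proof -
  have T: "T x y z = eta z * T x y xi" if "x \<in> V" "y \<in> V" "z \<in> V" for x y z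
    using assms that unfolding T7_def by (metis eta_xi mult_1 xi)
  have T_xi: "T xi y xi = 0" "T y xi xi = 0" if "y \<in> V" for y
  proof -
    have "T xi y xi = - T (phi xi) (phi y) xi" using assms that xi unfolding T7_def by blast
    then show "T xi y xi = 0" using that by simp
    then show "T y xi xi = 0" using that T_skew[of y xi xi] by simp
  qed
  have T_phi: "T (phi x) (phi y) xi = - T x y xi" if "x \<in> V" "y \<in> V" for x y
    using assms that xi unfolding T7_def by (metis minus_minus)
  have swap: "T (phi x) y xi = T x (phi y) xi" if "x \<in> V" "y \<in> V" for x y
    using T_phi[of x "phi y"] that by (simp add: T_xi)
  have F2: "2 * F x y z = - eta y * T x (phi z) xi - eta z * T x (phi y) xi"
    if [simp]: "x \<in> V" "y \<in> V" "z \<in> V" for x y z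
    using F_from_torsion[of x y z] T[of x y "phi z"] T[of y "phi z" x] T[of "phi z" x y]
      T[of x "phi y" z] T[of "phi y" z x] T[of z x "phi y"] swap[of y z]
      T_skew[of "phi z" x xi]
    by simp
  have F: "F x y z = - (eta y * T x (phi z) xi + eta z * T x (phi y) xi) / 2"
    if [simp]: "x \<in> V" "y \<in> V" "z \<in> V" for x y z
    using F2[OF that] by simp
  show ?thesis unfolding F7_def
  proof (intro ballI conjI)
    fix x y z assume [simp]: "x \<in> V" "y \<in> V" "z \<in> V"
    show "F x y z = F x y xi * eta z + F x z xi * eta y" by (simp add: F field_simps)
    show "F x y xi = - F y x xi"
      using T_skew[of y "phi x" xi] swap[of x y] by (simp add: F)
    show "F x y xi = - F (phi x) (phi y) xi" by (simp add: F swap T_xi)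
  qed
qed

text \<open>Both traces pair the symmetric \<open>h\<close> with a skew form on the kernel of \<open>\<eta>\<close>: \<open>F(x, y, \<xi>)\<close> is skew
  by definition of the class, and then \<open>F(x, \<phi> y, \<xi>) = F(\<phi> x, y, \<xi>) = -F(y, \<phi> x, \<xi>)\<close>.\<close>

lemma F7_traces:
  fixes k :: nat and e :: "nat \<Rightarrow> 'v" and h :: "nat \<Rightarrow> nat \<Rightarrow> real"
  assumes F7 and e: "\<And>i. i < k \<Longrightarrow> e i \<in> V \<and> eta (e i) = 0"
    and h: "\<And>i j. i < k \<Longrightarrow> j < k \<Longrightarrow> h i j = h j i" and z: "z \<in> V"
  shows "(\<Sum>i<k. \<Sum>j<k. h i j * F (e i) (e j) z) = 0"
    and "(\<Sum>i<k. \<Sum>j<k. h i j * F (e i) (phi (e j)) z) = 0"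
proof -
  have zero: "(\<Sum>i<k. \<Sum>j<k. h i j * B i j) = 0"
    if B: "\<And>i j. i < k \<Longrightarrow> j < k \<Longrightarrow> B i j = - B j i" for B :: "nat \<Rightarrow> nat \<Rightarrow> real"
  proof -
    have "(\<Sum>i<k. \<Sum>j<k. h i j * B i j) = (\<Sum>j<k. \<Sum>i<k. h i j * B i j)" by (rule sum.swap)
    also have "\<dots> = (\<Sum>j<k. \<Sum>i<k. - (h j i * B j i))"
      by (intro sum.cong refl) (metis B h lessThan_iff mult_minus_right)
    finally show ?thesis by (simp add: sum_negf)
  qed
  note F = F7_expand[OF assms(1)] and skew = F7_skew(1)[OF assms(1)]
    and swap = F7_phi_swap[OF assms(1)]
  show "(\<Sum>i<k. \<Sum>j<k. h i j * F (e i) (e j) z) = 0"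
  proof (rule zero)
    fix i j assume "i < k" "j < k"
    then show "F (e i) (e j) z = - F (e j) (e i) z" using e F[of "e i" "e j" z] F[of "e j" "e i" z]
      skew[of "e i" "e j"] z by simp
  qed
  show "(\<Sum>i<k. \<Sum>j<k. h i j * F (e i) (phi (e j)) z) = 0"
  proof (rule zero)
    fix i j assume "i < k" "j < k"
    then have "F (e i) (phi (e j)) xi = - F (e j) (phi (e i)) xi"
      using e swap[of "e i" "e j"] skew[of "phi (e i)" "e j"] by simp
    then show "F (e i) (phi (e j)) z = - F (e j) (phi (e i)) z"
      using \<open>i < k\<close> \<open>j < k\<close> e F[of "e i" "phi (e j)" z] F[of "e j" "phi (e i)" z] z by simp
  qed
qed

end

text \<open>Both sides equal \<open>\<Sum>a b. h i a * g (e a) (e b) * h j b\<close>, summed in different orders.\<close>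

lemma inverse_gram_sym:
  assumes h: "inverse_gram k g e h" and g: "\<And>i j. i < k \<Longrightarrow> j < k \<Longrightarrow> g (e i) (e j) = g (e j) (e i)"
    and "i < k" "j < k"
  shows "h i j = h j i"
proof -
  have inv: "(\<Sum>l<k. h i l * g (e l) (e j)) = (if i = j then 1 else 0)" if "i < k" "j < k" for i j
    using h that by (simp add: inverse_gram_def)
  let ?s = "\<lambda>a b. h i a * g (e a) (e b) * h j b"
  have "(\<Sum>a<k. \<Sum>b<k. ?s a b) = (\<Sum>a<k. h i a * (\<Sum>b<k. h j b * g (e b) (e a)))"
    unfolding sum_distrib_left by (intro sum.cong refl) (simp add: g mult_ac)
  also have "\<dots> = (\<Sum>a<k. h i a * (if j = a then 1 else 0))"
    by (intro sum.cong refl) (use inv \<open>j < k\<close> in simp)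
  also have "\<dots> = h i j" using \<open>j < k\<close> by (simp add: if_distrib cong: if_cong)
  finally have 1: "(\<Sum>a<k. \<Sum>b<k. ?s a b) = h i j" .
  have "(\<Sum>a<k. \<Sum>b<k. ?s a b) = (\<Sum>b<k. h j b * (\<Sum>a<k. h i a * g (e a) (e b)))"
    by (subst sum.swap) (simp add: sum_distrib_left mult_ac)
  also have "\<dots> = (\<Sum>b<k. h j b * (if i = b then 1 else 0))"
    by (intro sum.cong refl) (use inv \<open>i < k\<close> in simp)
  also have "\<dots> = h j i" using \<open>i < k\<close> by (simp add: if_distrib cong: if_cong)
  finally show ?thesis using 1 by simp
qed

section \<open>Calculus of smooth functions\<close>

lemma Ck_on_Suc_D:
  assumes "Ck_on (Suc k) U f" "open U" "x \<in> U"
  shows "(f has_derivative frechet_derivative f (at x)) (at x)"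
  using assms by (auto simp: differentiable_on_eq_differentiable_at simp flip: frechet_derivative_works)

lemma Ck_on_cong:
  assumes "open U" "\<And>x. x \<in> U \<Longrightarrow> f x = g x" "Ck_on k U f"
  shows "Ck_on k U g"
  using assms(2,3)
proof (induction k arbitrary: f g)
  case 0
  then show ?case using continuous_on_cong[of U U f g] by simp
next
  case (Suc k)
  have f': "(g has_derivative frechet_derivative f (at x)) (at x)" if x: "x \<in> U" for x
    by (rule has_derivative_transform_within_open[OF Ck_on_Suc_D[OF Suc.prems(2) assms(1) x] assms(1) x])
      (use Suc.prems in auto)
  have "Ck_on k U (\<lambda>x. frechet_derivative g (at x) v)" for v
  proof (rule Suc.IH)
    show "frechet_derivative f (at x) v = frechet_derivative g (at x) v" if "x \<in> U" for x
      using frechet_derivative_at[OF f'[OF that]] by simp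
    show "Ck_on k U (\<lambda>x. frechet_derivative f (at x) v)" using Suc.prems by simp
  qed
  then show ?case
    using f' by (auto simp: differentiable_on_eq_differentiable_at[OF assms(1)] differentiable_def)
qed

text \<open>This frees the induction step in \<open>Ck_on\<close> from the choice operator in \<open>frechet_derivative\<close>:
  any expression for the derivative will do.\<close>

lemma Ck_onI:
  assumes "open U" and f': "\<And>x. x \<in> U \<Longrightarrow> (f has_derivative f' x) (at x)"
    and "\<And>v. Ck_on k U (\<lambda>x. f' x v)"
  shows "Ck_on (Suc k) U f"
proof -
  have "Ck_on k U (\<lambda>x. frechet_derivative f (at x) v)" for v
    by (rule Ck_on_cong[OF assms(1) _ assms(3)[of v]]) (simp add: frechet_derivative_at[OF f', symmetric])
  then show ?thesis
    using f' by (auto simp: differentiable_on_eq_differentiable_at[OF assms(1)] differentiable_def)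
qed

lemma Ck_on_continuous: "Ck_on k U f \<Longrightarrow> continuous_on U f"
  by (cases k) (auto intro: differentiable_imp_continuous_on)

lemma Ck_on_Suc: "Ck_on (Suc k) U f \<Longrightarrow> Ck_on k U f"
proof (induction k arbitrary: f)
  case 0
  then show ?case by (metis Ck_on.simps(1) Ck_on_continuous)
next
  case (Suc k)
  have "Ck_on k U (\<lambda>x. frechet_derivative f (at x) v)" for v
    by (rule Suc.IH) (use Suc.prems in simp)
  then show ?case using Suc.prems by simp
qed

lemma Ck_on_subset: "Ck_on k U f \<Longrightarrow> W \<subseteq> U \<Longrightarrow> Ck_on k W f"
  by (induction k arbitrary: f) (auto intro: continuous_on_subset differentiable_on_subset)

lemma Ck_on_Un:
  "open U \<Longrightarrow> open W \<Longrightarrow> Ck_on k U f \<Longrightarrow> Ck_on k W f \<Longrightarrow> Ck_on k (U \<union> W) f"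
  by (induction k arbitrary: f)
    (auto intro: continuous_on_open_Un simp: differentiable_on_eq_differentiable_at open_Un)

lemma Ck_on_const: "open U \<Longrightarrow> Ck_on k U (\<lambda>x. c)"
proof (induction k arbitrary: c)
  case (Suc k)
  show ?case by (rule Ck_onI[where f' = "\<lambda>x v. 0"]) (use Suc in \<open>auto intro: derivative_eq_intros\<close>)
qed simp

lemma Ck_on_bounded_linear:
  assumes "bounded_linear L" "open U" shows "Ck_on k U L"
proof (cases k)
  case 0 then show ?thesis using assms by (simp add: linear_continuous_on)
next
  case (Suc j)
  show ?thesis unfolding Suc
    by (rule Ck_onI[where f' = "\<lambda>x. L"])
      (use assms in \<open>auto intro: bounded_linear_imp_has_derivative Ck_on_const\<close>)
qed

lemma Ck_on_add:
  assumes "open U" shows "Ck_on k U f \<Longrightarrow> Ck_on k U g \<Longrightarrow> Ck_on k U (\<lambda>x. f x + g x)"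
proof (induction k arbitrary: f g)
  case (Suc k)
  show ?case
  proof (rule Ck_onI[OF assms])
    show "((\<lambda>x. f x + g x) has_derivative
        (\<lambda>v. frechet_derivative f (at x) v + frechet_derivative g (at x) v)) (at x)" if "x \<in> U" for x
      by (rule has_derivative_add) (use Ck_on_Suc_D Suc.prems assms that in blast)+
  qed (use Suc in simp)
qed (simp add: continuous_on_add)

lemma Ck_on_sum:
  assumes "open U" "\<And>i. i \<in> I \<Longrightarrow> Ck_on k U (f i)" shows "Ck_on k U (\<lambda>x. \<Sum>i\<in>I. f i x)"
  using assms(2)
  by (induction I rule: infinite_finite_induct) (auto intro: Ck_on_const Ck_on_add assms(1))

lemma Ck_on_linear_comp:
  assumes "open U" "bounded_linear L" shows "Ck_on k U f \<Longrightarrow> Ck_on k U (\<lambda>x. L (f x))"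
proof (induction k arbitrary: f)
  case 0 then show ?case by (simp add: bounded_linear.continuous_on[OF assms(2)])
next
  case (Suc k)
  show ?case
  proof (rule Ck_onI[where f' = "\<lambda>x v. L (frechet_derivative f (at x) v)", OF assms(1)])
    show "((\<lambda>x. L (f x)) has_derivative (\<lambda>v. L (frechet_derivative f (at x) v))) (at x)" if "x \<in> U" for x
      by (rule bounded_linear.has_derivative[OF assms(2) Ck_on_Suc_D[OF Suc.prems assms(1) that]])
  qed (use Suc in simp)
qed

lemma Ck_on_scaleR:
  assumes "open U" shows "Ck_on k U f \<Longrightarrow> Ck_on k U g \<Longrightarrow> Ck_on k U (\<lambda>x. f x *\<^sub>R g x)"
proof (induction k arbitrary: f g)
  case (Suc k)
  show ?case
  proof (rule Ck_onI[OF assms])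
    show "((\<lambda>x. f x *\<^sub>R g x) has_derivative
        (\<lambda>v. f x *\<^sub>R frechet_derivative g (at x) v + frechet_derivative f (at x) v *\<^sub>R g x)) (at x)"
      if "x \<in> U" for x
      by (rule has_derivative_scaleR) (use Ck_on_Suc_D Suc.prems assms that in blast)+
    show "Ck_on k U (\<lambda>x. f x *\<^sub>R frechet_derivative g (at x) v + frechet_derivative f (at x) v *\<^sub>R g x)" for v
      using Suc.IH Suc.prems Ck_on_Suc[OF Suc.prems(1)] Ck_on_Suc[OF Suc.prems(2)]
      by (intro Ck_on_add assms Suc.IH) simp_all
  qed
qed (simp add: continuous_on_scaleR)

lemma Ck_on_mult:
  "open U \<Longrightarrow> Ck_on k U f \<Longrightarrow> Ck_on k U g \<Longrightarrow> Ck_on k U (\<lambda>x. f x * g x :: real)"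
  using Ck_on_scaleR[of U k f g] by simp

text \<open>By the chain rule \<open>(f \<circ> g)'(x) v\<close> is the value of \<open>f'(g x)\<close> at a vector depending on \<open>x\<close>.
  Expanding that vector in the basis yields derivatives of \<open>f\<close> in fixed directions, composed with
  \<open>g\<close>, to which the induction hypothesis applies.\<close>

lemma Ck_on_compose:
  fixes f :: "'b::euclidean_space \<Rightarrow> 'c::real_normed_vector" and g :: "'a::euclidean_space \<Rightarrow> 'b"
  assumes "open U" "open W" "g ` U \<subseteq> W"
  shows "Ck_on k W f \<Longrightarrow> Ck_on k U g \<Longrightarrow> Ck_on k U (\<lambda>x. f (g x))"
proof (induction k arbitrary: f)
  case 0 then show ?case using continuous_on_compose2 assms(3) by auto
next
  case (Suc k)
  let ?f' = "\<lambda>x. frechet_derivative f (at x)" and ?g' = "\<lambda>x. frechet_derivative g (at x)"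
  show ?case
  proof (rule Ck_onI[OF assms(1)])
    fix x assume x: "x \<in> U"
    then have gx: "g x \<in> W" using assms by auto
    have f': "(f has_derivative ?f' (g x)) (at (g x))" by (rule Ck_on_Suc_D[OF Suc.prems(1) assms(2) gx])
    then have lin: "linear (?f' (g x))" using has_derivative_linear by blast
    have D: "((\<lambda>x. f (g x)) has_derivative (\<lambda>v. ?f' (g x) (?g' x v))) (at x)"
      by (rule has_derivative_compose[OF Ck_on_Suc_D[OF Suc.prems(2) assms(1) x] f'])
    have rep: "(\<Sum>i\<in>Basis. (v \<bullet> i) *\<^sub>R ?f' (g x) i) = ?f' (g x) v" for v
      using linear_sum[OF lin, of "\<lambda>i. (v \<bullet> i) *\<^sub>R i" Basis]
      by (simp add: linear_cmul[OF lin] euclidean_representation)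
    show "((\<lambda>x. f (g x)) has_derivative
        (\<lambda>v. \<Sum>i\<in>Basis. (?g' x v \<bullet> i) *\<^sub>R ?f' (g x) i)) (at x)"
      unfolding rep by (rule D)
  next
    fix v
    show "Ck_on k U (\<lambda>x. \<Sum>i\<in>Basis. (?g' x v \<bullet> i) *\<^sub>R ?f' (g x) i)"
    proof (intro Ck_on_sum Ck_on_scaleR assms(1))
      show "Ck_on k U (\<lambda>x. ?g' x v \<bullet> i)" for i
        by (rule Ck_on_linear_comp[OF assms(1) bounded_linear_inner_left]) (use Suc.prems in simp)
      show "Ck_on k U (\<lambda>x. ?f' (g x) i)" for i
        by (rule Suc.IH) (use Suc.prems Ck_on_Suc in auto)
    qed
  qed
qed

section \<open>Bump functions\<close>

text \<open>The powers of \<open>1/t\<close> make the family \<open>exp(-1/t) / t^k\<close>, extended by \<open>0\<close>, closed under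
  differentiation up to linear combinations. Hence \<open>C^m\<close> for the whole family follows by
  induction on \<open>m\<close>, without higher derivatives being computed.\<close>

definition flat :: "nat \<Rightarrow> real \<Rightarrow> real" where
  "flat k t = (if t > 0 then exp (- (1 / t)) / t ^ k else 0)"

lemma flat_tendsto_0: "(flat k \<longlongrightarrow> 0) (at 0)"
proof -
  have "((\<lambda>t. inverse t ^ k / exp (inverse t)) \<longlongrightarrow> (0::real)) (at_right 0)"
    by (rule filterlim_compose[OF tendsto_power_div_exp_0 filterlim_inverse_at_top_right])
  then have R: "(flat k \<longlongrightarrow> 0) (at_right 0)"
  proof (rule Lim_transform_eventually)
    show "\<forall>\<^sub>F t in at_right 0. inverse t ^ k / exp (inverse t) = flat k t"
      by (rule eventually_at_right_less[THEN eventually_mono])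
        (simp add: flat_def exp_minus field_simps)
  qed
  have "(flat k \<longlongrightarrow> 0) (at_left 0)"
    by (rule Lim_transform_eventually[OF tendsto_const])
      (simp add: flat_def eventually_at_filter)
  then show ?thesis using R by (simp add: filterlim_split_at)
qed

lemma flat_deriv: "(flat k has_real_derivative flat (k + 2) t - k * flat (k + 1) t) (at t)"
proof (cases t "0::real" rule: linorder_cases)
  case less
  have "((\<lambda>t. 0) has_real_derivative 0) (at t)" by simp
  then have "(flat k has_real_derivative 0) (at t)"
    by (rule has_field_derivative_transform_within_open[where S = "{..<0}"]) (use less in \<open>auto simp: flat_def\<close>)
  then show ?thesis using less by (simp add: flat_def)
next
  case greater
  have "((\<lambda>t. exp (- (1 / t)) / t ^ k) has_real_derivative flat (k + 2) t - k * flat (k + 1) t) (at t)"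
    using greater
    by (cases k) (auto intro!: derivative_eq_intros simp: flat_def field_simps power2_eq_square,
        metis One_nat_def power_eq_if)
  then show ?thesis
    by (rule has_field_derivative_transform_within_open[where S = "{0<..}"]) (use greater in \<open>auto simp: flat_def\<close>)
next
  case equal
  have "((\<lambda>h. (flat k (0 + h) - flat k 0) / h) \<longlongrightarrow> 0) (at 0)"
    using flat_tendsto_0[of "k + 1"]
    by (rule Lim_transform_eventually) (auto simp: flat_def eventually_at_filter)
  then show ?thesis using equal by (simp add: DERIV_def flat_def)
qed

lemma Ck_on_flat: "Ck_on m UNIV (flat k)"
proof (induction m arbitrary: k)
  case 0
  then show ?case using DERIV_isCont[OF flat_deriv] by (simp add: continuous_at_imp_continuous_on)
next
  case (Suc m)
  show ?case
  proof (rule Ck_onI[where f' = "\<lambda>t v. (flat (k + 2) t + (- real k) * flat (k + 1) t) * v"])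
    show "(flat k has_derivative (\<lambda>v. (flat (k + 2) t + - real k * flat (k + 1) t) * v)) (at t)" for t
      using flat_deriv[of k t] by (simp add: has_field_derivative_def)
    show "Ck_on m UNIV (\<lambda>t. (flat (k + 2) t + - real k * flat (k + 1) t) * v)" for v
      by (intro Ck_on_mult Ck_on_add Ck_on_const Suc.IH open_UNIV)
  qed simp
qed

lemma smooth_bump:
  fixes a :: "'a::euclidean_space"
  assumes "open W" "a \<in> W"
  obtains b :: "'a \<Rightarrow> real" and K
  where "smooth_on UNIV b" "b a = 1" "compact K" "K \<subseteq> W" "\<And>x. x \<notin> K \<Longrightarrow> b x = 0"
proof -
  obtain r where r: "r > 0" "cball a r \<subseteq> W" using assms open_contains_cball by metis
  (* The squared distance is written with sums and products only, to match the closure rules for Ck_on;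
     the factor normalises the value at the centre. *)
  define b where "b x = exp (1 / r\<^sup>2) *
    flat 0 (r\<^sup>2 + - 1 * (\<Sum>i\<in>Basis. (x \<bullet> i + - (a \<bullet> i)) * (x \<bullet> i + - (a \<bullet> i))))" for x
  have b: "b x = exp (1 / r\<^sup>2) * flat 0 (r\<^sup>2 - (dist a x)\<^sup>2)" for x
  proof -
    have "(\<Sum>i\<in>Basis. (x \<bullet> i + - (a \<bullet> i)) * (x \<bullet> i + - (a \<bullet> i))) = (x - a) \<bullet> (x - a)"
      by (subst euclidean_inner) (simp add: inner_diff_left)
    also have "\<dots> = (dist a x)\<^sup>2" by (simp add: dist_commute[of a x] dist_norm[of x a] power2_norm_eq_inner)
    finally show ?thesis by (simp add: b_def)
  qed
  show ?thesis
  proof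
    show "smooth_on UNIV b" unfolding smooth_on_def b_def
    proof
      fix k
      show "Ck_on k UNIV (\<lambda>x. exp (1 / r\<^sup>2) * flat 0 (r\<^sup>2 + - 1 * (\<Sum>i\<in>Basis. (x \<bullet> i + - (a \<bullet> i)) * (x \<bullet> i + - (a \<bullet> i)))))"
        by (intro Ck_on_mult Ck_on_const Ck_on_add Ck_on_sum open_UNIV subset_UNIV Ck_on_flat
            Ck_on_compose[where f = "flat 0" and W = UNIV]
            Ck_on_bounded_linear bounded_linear_inner_left)
    qed
    show "b a = 1" using r by (simp add: b flat_def flip: exp_add)
    show "compact (cball a r)" by simp
    show "cball a r \<subseteq> W" by (rule r)
    show "b x = 0" if "x \<notin> cball a r" for x
      using that r by (auto simp: b flat_def dest: power2_less_imp_less)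
  qed
qed

section \<open>Vector fields through a given tangent vector\<close>

lemma span_card_eqI:
  assumes "finite B" "independent S" "S \<subseteq> span B" "card S = card B"
  shows "span B \<subseteq> span (S :: 'a::real_vector set)"
proof
  fix x assume x: "x \<in> span B"
  show "x \<in> span S"
  proof (rule ccontr)
    assume n: "x \<notin> span S"
    then have "independent (insert x S)" using assms(2) by (rule independent_insertI)
    then have "finite (insert x S) \<and> card (insert x S) \<le> card B"
      using independent_span_bound[OF assms(1), of "insert x S"] x assms(3) by simp
    moreover have "x \<notin> S" using n span_base by blast
    ultimately show False using assms(4) by auto
  qed
qed

locale smooth_manifold =
  fixes A :: "('m::t2_space, 'e::euclidean_space) chart set"
  assumes atlas: "smooth_atlas A"
begin

lemma chartD:
  assumes "(U, c) \<in> A"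
  shows "open U" "open (c ` U)" "homeomorphism U (c ` U) c (inv_into U c)"
  using assms atlas by (auto simp: smooth_atlas_def)

lemma inv_chart [simp]:
  assumes "(U, c) \<in> A" "q \<in> U" shows "inv_into U c (c q) = q"
  using chartD(3)[OF assms(1)] assms(2) by (simp add: homeomorphism_def)

lemma open_chart_image:
  assumes "(U, c) \<in> A" "open W" "W \<subseteq> U" shows "open (c ` W)"
proof -
  have "openin (top_of_set (c ` U)) (c ` W)"
    by (rule homeomorphism_imp_open_map[OF chartD(3)[OF assms(1)]])
      (use assms chartD(1) in \<open>simp add: openin_open_eq\<close>)
  then show ?thesis using chartD(2)[OF assms(1)] by (simp add: openin_open_eq)
qed

lemma transition_smooth:
  assumes "(U, c) \<in> A" "(W, d) \<in> A" shows "smooth_on (c ` (U \<inter> W)) (\<lambda>x. d (inv_into U c x))"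
  using assms atlas by (auto simp: smooth_atlas_def comp_def)

lemma smooth_functionsD:
  assumes "f \<in> smooth_functions A" "(U, c) \<in> A" shows "Ck_on k (c ` U) (\<lambda>x. f (inv_into U c x))"
  using assms by (auto simp: smooth_functions_def smooth_on_def comp_def)

lemma smooth_functionsI:
  assumes "\<And>U c k. (U, c) \<in> A \<Longrightarrow> Ck_on k (c ` U) (\<lambda>x. f (inv_into U c x))"
  shows "f \<in> smooth_functions A"
  using assms by (auto simp: smooth_functions_def smooth_on_def comp_def)

lemma smooth_const: "(\<lambda>q. a) \<in> smooth_functions A"
  by (rule smooth_functionsI) (auto intro: Ck_on_const chartD)

lemma smooth_add: "f \<in> smooth_functions A \<Longrightarrow> h \<in> smooth_functions A \<Longrightarrow> (\<lambda>q. f q + h q) \<in> smooth_functions A"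
  by (rule smooth_functionsI) (auto intro: Ck_on_add chartD smooth_functionsD)

lemma smooth_mult: "f \<in> smooth_functions A \<Longrightarrow> h \<in> smooth_functions A \<Longrightarrow> (\<lambda>q. f q * h q) \<in> smooth_functions A"
  by (rule smooth_functionsI) (auto intro: Ck_on_mult chartD smooth_functionsD)

text \<open>The support, being compact, is closed in \<open>M\<close> because \<open>M\<close> is Hausdorff. So any other chart domain
  is covered by two open sets: the overlap with \<open>U\<close>, where the function is a composite with the
  change of coordinates, and the complement of the support, where it vanishes.\<close>

lemma extension_by_zero_smooth:
  assumes U: "(U, c) \<in> A" and u: "\<And>k. Ck_on k (c ` U) u"
    and K: "compact K" "K \<subseteq> c ` U" "\<And>x. x \<in> c ` U \<Longrightarrow> x \<notin> K \<Longrightarrow> u x = (0::real)"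
  shows "(\<lambda>q. if q \<in> U then u (c q) else 0) \<in> smooth_functions A"
proof (rule smooth_functionsI)
  fix W d k assume W: "(W, d) \<in> A"
  let ?f = "\<lambda>q. if q \<in> U then u (c q) else 0" and ?i = "inv_into W d"
  define C where "C = inv_into U c ` K"
  have "continuous_on K (inv_into U c)"
    using chartD(3)[OF U] K(2) by (meson homeomorphism_def continuous_on_subset)
  then have "closed C" unfolding C_def using K(1) by (simp add: compact_continuous_image compact_imp_closed)
  then have o: "open (d ` (W \<inter> U))" "open (d ` (W - C))"
    using open_chart_image[OF W] chartD(1)[OF W] chartD(1)[OF U] by (simp_all add: open_Int open_Diff)
  have "C \<subseteq> U" using K(2) inv_chart[OF U] by (auto simp: C_def)
  then have Wd: "d ` W = d ` (W \<inter> U) \<union> d ` (W - C)" by auto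
  have zero: "?f q = 0" if "q \<notin> C" for q
  proof (cases "q \<in> U")
    case True
    then have "c q \<notin> K" using that inv_chart[OF U True] by (force simp: C_def)
    then show ?thesis using K(3) True by simp
  qed simp
  have "Ck_on k (d ` (W \<inter> U)) (\<lambda>x. u (c (?i x)))"
    by (rule Ck_on_compose[OF o(1) chartD(2)[OF U] _ u])
      (use W inv_chart[OF W] transition_smooth[OF W U] in \<open>auto simp: smooth_on_def\<close>)
  then have 1: "Ck_on k (d ` (W \<inter> U)) (\<lambda>x. ?f (?i x))"
    by (rule Ck_on_cong[OF o(1), rotated]) (use inv_chart[OF W] in auto)
  have 2: "Ck_on k (d ` (W - C)) (\<lambda>x. ?f (?i x))"
  proof (rule Ck_on_cong[OF o(2) _ Ck_on_const[OF o(2), of _ 0]])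
    fix x assume "x \<in> d ` (W - C)"
    then obtain q where "q \<in> W" "q \<notin> C" "x = d q" by blast
    then show "0 = ?f (?i x)" using zero[of q] inv_chart[OF W] by (simp split: if_split_asm)
  qed
  show "Ck_on k (d ` W) (\<lambda>x. ?f (?i x))"
    unfolding Wd by (rule Ck_on_Un[OF o 1 2])
qed

text \<open>The field \<open>u \<cdot> \<partial>\<^sub>w\<close>, where \<open>\<partial>\<^sub>w\<close> is the derivative in the constant direction \<open>w\<close> of the chart
  \<open>(U, c)\<close>, extended by \<open>0\<close> outside \<open>U\<close>.\<close>

definition coordinate_field :: "'m set \<Rightarrow> ('m \<Rightarrow> 'e) \<Rightarrow> ('e \<Rightarrow> real) \<Rightarrow> 'e \<Rightarrow> 'm vfield" where
  "coordinate_field U c u w = (\<lambda>q f. if q \<in> U \<and> f \<in> smooth_functions A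
     then u (c q) * frechet_derivative (\<lambda>x. f (inv_into U c x)) (at (c q)) w else 0)"

lemma smooth_has_derivative:
  assumes "(U, c) \<in> A" "f \<in> smooth_functions A" "q \<in> U"
  shows "((\<lambda>x. f (inv_into U c x)) has_derivative
     frechet_derivative (\<lambda>x. f (inv_into U c x)) (at (c q))) (at (c q))"
  using Ck_on_Suc_D[OF smooth_functionsD[OF assms(2,1)] chartD(2)[OF assms(1)]] assms(3) by blast

lemma coordinate_field_tangent:
  assumes U: "(U, c) \<in> A"
  shows "coordinate_field U c u w q \<in> tangent_space A q"
proof (cases "q \<in> U")
  case False
  then show ?thesis by (simp add: coordinate_field_def tangent_space_def linear_map_on_def)
next
  case q: True
  let ?i = "inv_into U c"
  let ?D = "\<lambda>f. frechet_derivative (\<lambda>x. f (?i x)) (at (c q))"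
  note d = smooth_has_derivative[OF U _ q]
  have add: "?D (\<lambda>q. f q + h q) w = ?D f w + ?D h w"
    and mult: "?D (\<lambda>q. f q * h q) w = f q * ?D h w + h q * ?D f w"
    if "f \<in> smooth_functions A" "h \<in> smooth_functions A" for f h
  proof -
    show "?D (\<lambda>q. f q + h q) w = ?D f w + ?D h w"
      using frechet_derivative_at[OF has_derivative_add[OF d[OF that(1)] d[OF that(2)]], symmetric]
      by simp
    show "?D (\<lambda>q. f q * h q) w = f q * ?D h w + h q * ?D f w"
      using frechet_derivative_at[OF has_derivative_mult[OF d[OF that(1)] d[OF that(2)]], symmetric]
        inv_chart[OF U q] by (simp add: mult.commute)
  qed
  have scale: "?D (\<lambda>q. a * f q) w = a * ?D f w" if "f \<in> smooth_functions A" for f a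
    using frechet_derivative_at[OF has_derivative_mult_right[OF d[OF that], of a], symmetric] by simp
  show ?thesis
    using q smooth_add smooth_mult smooth_mult[OF smooth_const]
    by (simp add: add mult scale coordinate_field_def tangent_space_def linear_map_on_def
        plus_fun_def times_fun_def scaleR_fun_def distrib_left mult.assoc mult.left_commute)
qed

lemma coordinate_field_vector_field:
  assumes U: "(U, c) \<in> A" and u: "smooth_on UNIV u"
    and K: "compact K" "K \<subseteq> c ` U" "\<And>x. x \<notin> K \<Longrightarrow> u x = 0"
  shows "coordinate_field U c u w \<in> vector_fields A"
  unfolding vector_fields_def
proof (intro CollectI conjI allI ballI)
  show "coordinate_field U c u w p \<in> tangent_space A p" for p
    by (rule coordinate_field_tangent[OF U])
  fix f assume f: "f \<in> smooth_functions A"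
  let ?g = "\<lambda>y. u y * frechet_derivative (\<lambda>x. f (inv_into U c x)) (at y) w"
  have "(\<lambda>p. coordinate_field U c u w p f) = (\<lambda>q. if q \<in> U then ?g (c q) else 0)"
    using f by (auto simp: coordinate_field_def)
  also have "\<dots> \<in> smooth_functions A"
  proof (rule extension_by_zero_smooth[OF U _ K(1,2)])
    show "Ck_on k (c ` U) ?g" for k
    proof (rule Ck_on_mult[OF chartD(2)[OF U]])
      show "Ck_on k (c ` U) u" using u by (auto simp: smooth_on_def intro: Ck_on_subset)
      show "Ck_on k (c ` U) (\<lambda>y. frechet_derivative (\<lambda>x. f (inv_into U c x)) (at y) w)"
        using smooth_functionsD[OF f U, of "Suc k"] by simp
    qed
  qed (use K(3) in simp)
  finally show "(\<lambda>p. coordinate_field U c u w p f) \<in> smooth_functions A" .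
qed

lemma tangent_space_subspace: "subspace (tangent_space A p)"
proof (rule subspaceI)
  show "0 \<in> tangent_space A p" by (simp add: tangent_space_def linear_map_on_def)
  show "v + w \<in> tangent_space A p" if "v \<in> tangent_space A p" "w \<in> tangent_space A p" for v w
    using that by (simp add: tangent_space_def linear_map_on_def algebra_simps)
  show "a *\<^sub>R v \<in> tangent_space A p" if "v \<in> tangent_space A p" for a v
    using that by (simp add: tangent_space_def linear_map_on_def scaleR_fun_def algebra_simps)
qed

text \<open>The fields \<open>b \<cdot> \<partial>\<^sub>w\<close>, with a bump function \<open>b\<close> in a chart at \<open>p\<close>, are smooth, and at \<open>p\<close> they give a
  linear map \<open>L\<close> from the model space to the derivations at \<open>p\<close>. It is injective: applied to \<open>b\<close>
  times the coordinate along \<open>w\<close> centred at \<open>p\<close>, \<open>L w\<close> yields \<open>w \<bullet> w\<close>. As the tangent space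
  is assumed to have the dimension of the model space, \<open>L\<close> is onto it.\<close>

lemma vector_field_through:
  assumes basis: "is_basis DIM('e) e (tangent_space A p)" and v: "v \<in> tangent_space A p"
  shows "\<exists>X\<in>vector_fields A. X p = v"
proof -
  have "p \<in> (\<Union>(U, c)\<in>A. U)" using atlas by (simp add: smooth_atlas_def)
  then obtain U c where U: "(U, c) \<in> A" and p: "p \<in> U" by blast
  obtain b :: "'e \<Rightarrow> real" and K where b: "smooth_on UNIV b" "b (c p) = 1"
    and K: "compact K" "K \<subseteq> c ` U" "\<And>x. x \<notin> K \<Longrightarrow> b x = 0"
    using smooth_bump[OF chartD(2)[OF U] imageI[OF p]] by blast
  define L where "L w = coordinate_field U c b w p" for w
  have fd: "linear (frechet_derivative (\<lambda>x. f (inv_into U c x)) (at (c p)))" if "f \<in> smooth_functions A" for f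
    using smooth_has_derivative[OF U that p] has_derivative_linear by blast
  have lin: "linear L"
  proof (rule linearI)
    show "L (w + w') = L w + L w'" for w w'
      unfolding L_def coordinate_field_def by (auto simp: b p linear_add[OF fd])
    show "L (a *\<^sub>R w) = a *\<^sub>R L w" for a w
      unfolding L_def coordinate_field_def by (auto simp: b p linear_cmul[OF fd] scaleR_fun_def)
  qed
  have bU: "Ck_on k (c ` U) b" for k
    using b(1) by (auto simp: smooth_on_def intro: Ck_on_subset)
  have "w = 0" if "L w = 0" for w
  proof -
    let ?g = "\<lambda>y. b y * (y \<bullet> w + - (c p \<bullet> w))"
    define f where "f q = (if q \<in> U then ?g (c q) else 0)" for q
    have f: "f \<in> smooth_functions A" unfolding f_def
    proof (rule extension_by_zero_smooth[OF U _ K(1,2)])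
      show "Ck_on k (c ` U) ?g" for k
        by (intro Ck_on_mult Ck_on_add Ck_on_const chartD(2)[OF U] bU
            Ck_on_bounded_linear[OF bounded_linear_inner_left])
    qed (use K in simp)
    have "(b has_derivative frechet_derivative b (at (c p))) (at (c p))"
      by (rule Ck_on_Suc_D[of 0 UNIV]) (use b in \<open>auto simp: smooth_on_def simp del: Ck_on.simps\<close>)
    then have "(?g has_derivative (\<lambda>y. y \<bullet> w)) (at (c p))"
      by (auto intro!: derivative_eq_intros simp: b)
    then have "((\<lambda>x. f (inv_into U c x)) has_derivative (\<lambda>y. y \<bullet> w)) (at (c p))"
      by (rule has_derivative_transform_within_open[OF _ chartD(2)[OF U]])
        (use p inv_chart[OF U] in \<open>auto simp: f_def\<close>)
    then have "L w f = w \<bullet> w"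
      using f p b by (simp add: L_def coordinate_field_def flip: frechet_derivative_at)
    then show "w = 0" using that by simp
  qed
  then have inj: "inj L" using linear_injective_0[OF lin] by blast
  let ?B = "e ` {..<DIM('e)}"
  have B: "finite ?B" "span ?B = tangent_space A p" "card ?B = DIM('e)"
    using basis by (auto simp: is_basis_def card_image)
  have "independent (L ` Basis)"
    by (rule linear_independent_injective_image[OF lin independent_Basis inj_on_subset[OF inj]]) simp
  moreover have "L ` Basis \<subseteq> span ?B" unfolding B L_def using coordinate_field_tangent[OF U] by blast
  moreover have "card (L ` Basis) = card ?B" using B inj by (simp add: card_image inj_on_subset)
  ultimately have "v \<in> span (L ` Basis)" using span_card_eqI[OF B(1)] v B(2) by blast
  then have "v \<in> range L" by (simp add: span_Basis linear_span_image[OF lin])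
  then show ?thesis unfolding L_def using coordinate_field_vector_field[OF U b(1) K] by blast
qed

end

section \<open>The symmetries of \<open>F\<close>\<close>

locale acb_manifold =
  fixes S :: "('m::{t2_space, second_countable_topology}, 'e::euclidean_space) acbm"
    and n :: nat and LC :: "'m connection"
  assumes acb: "almost_contact_B_metric_manifold n S"
    and metric: "metric_connection S LC"

sublocale acb_manifold \<subseteq> smooth_manifold "atlas S"
  using acb by unfold_locales (simp add: almost_contact_B_metric_manifold_def)

context acb_manifold
begin

abbreviation "VF \<equiv> vector_fields (atlas S)"
abbreviation "g \<equiv> metric S"

lemma VF_tangent [simp]: "Y \<in> VF \<Longrightarrow> Y p \<in> tangent S p"
  by (auto simp: vector_fields_def)

lemma tangent_closed [simp]:
  "0 \<in> tangent S p"
  "u \<in> tangent S p \<Longrightarrow> v \<in> tangent S p \<Longrightarrow> u + v \<in> tangent S p"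
  "u \<in> tangent S p \<Longrightarrow> v \<in> tangent S p \<Longrightarrow> u - v \<in> tangent S p"
  "u \<in> tangent S p \<Longrightarrow> - u \<in> tangent S p"
  "u \<in> tangent S p \<Longrightarrow> a *\<^sub>R u \<in> tangent S p"
  using tangent_space_subspace[of p] by (auto simp: subspace_def subspace_diff subspace_neg)

lemma structure_tensors:
  shows phi_linear: "linear_map_on (tangent S p) (phi S p)"
    and phi_in [simp]: "x \<in> tangent S p \<Longrightarrow> phi S p x \<in> tangent S p"
    and phi_VF [simp]: "Y \<in> VF \<Longrightarrow> (\<lambda>q. phi S q (Y q)) \<in> VF"
    and xi_VF [simp]: "xi S \<in> VF"
    and eta_linear: "linear_map_on (tangent S p) (eta S p)"
    and eta_smooth: "Y \<in> VF \<Longrightarrow> (\<lambda>q. eta S q (Y q)) \<in> smooth_functions (atlas S)"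
    and phi_xi [simp]: "phi S p (xi S p) = 0"
    and eta_xi [simp]: "eta S p (xi S p) = 1"
    and phi_phi: "x \<in> tangent S p \<Longrightarrow> phi S p (phi S p x) = - x + eta S p x *\<^sub>R xi S p"
    and eta_phi [simp]: "x \<in> tangent S p \<Longrightarrow> eta S p (phi S p x) = 0"
    and g_phi_phi: "x \<in> tangent S p \<Longrightarrow> y \<in> tangent S p \<Longrightarrow>
      g p (phi S p x) (phi S p y) = - g p x y + eta S p x * eta S p y"
    and g_linear: "x \<in> tangent S p \<Longrightarrow> linear_map_on (tangent S p) (g p x)"
    and g_sym: "x \<in> tangent S p \<Longrightarrow> y \<in> tangent S p \<Longrightarrow> g p x y = g p y x"
    and g_signature: "has_signature (tangent S p) (g p) n (n + 1)"
    and dimension: "DIM('e) = n + (n + 1)"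
  using acb unfolding almost_contact_B_metric_manifold_def smooth_endomorphism_field_def
    smooth_one_form_def pseudo_riemannian_metric_def by (auto simp: image_subset_iff)

lemmas linear_on_tangentD = linear_map_onD[OF tangent_space_subspace]

lemma g_linear1: "x \<in> tangent S p \<Longrightarrow> linear_map_on (tangent S p) (\<lambda>y. g p y x)"
  using g_linear[of x p] by (simp add: linear_map_on_def g_sym[of _ p x])

lemmas lin = linear_on_tangentD[OF g_linear] linear_on_tangentD[OF g_linear1]
  linear_on_tangentD[OF phi_linear] linear_on_tangentD[OF eta_linear]

lemma g_xi: "x \<in> tangent S p \<Longrightarrow> g p x (xi S p) = eta S p x"
  using g_phi_phi[of x p "xi S p"] by (simp add: lin)

lemma g_phi:
  assumes [simp]: "x \<in> tangent S p" "y \<in> tangent S p"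
  shows "g p (phi S p x) y = g p x (phi S p y)"
  using g_phi_phi[of x p "phi S p y"] by (simp add: lin phi_phi g_xi)

lemma extension_props:
  assumes "v \<in> tangent S p"
  shows "extension (atlas S) p v \<in> VF" "extension (atlas S) p v p = v"
proof -
  obtain e where "is_basis (n + (n + 1)) e (tangent S p)"
    using g_signature[of p] by (auto simp: has_signature_def)
  then have "\<exists>X. X \<in> VF \<and> X p = v"
    using vector_field_through[of e p v] assms by (auto simp: dimension)
  from someI_ex[OF this] show "extension (atlas S) p v \<in> VF" "extension (atlas S) p v p = v"
    by (simp_all add: extension_def)
qed

lemma connection:
  shows LC_in [simp]: "x \<in> tangent S p \<Longrightarrow> Y \<in> VF \<Longrightarrow> LC p x Y \<in> tangent S p"
    and LC_linear: "Y \<in> VF \<Longrightarrow> linear_map_on (tangent S p) (\<lambda>x. LC p x Y)"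
    and LC_add: "x \<in> tangent S p \<Longrightarrow> Y \<in> VF \<Longrightarrow> Z \<in> VF \<Longrightarrow>
      LC p x (\<lambda>q. Y q + Z q) = LC p x Y + LC p x Z"
    and LC_scale: "x \<in> tangent S p \<Longrightarrow> f \<in> smooth_functions (atlas S) \<Longrightarrow> Y \<in> VF \<Longrightarrow>
      LC p x (\<lambda>q. f q *\<^sub>R Y q) = x f *\<^sub>R Y p + f p *\<^sub>R LC p x Y"
    and LC_metric: "x \<in> tangent S p \<Longrightarrow> Y \<in> VF \<Longrightarrow> Z \<in> VF \<Longrightarrow>
      x (\<lambda>q. g q (Y q) (Z q)) = g p (LC p x Y) (Z p) + g p (Y p) (LC p x Z)"
  using metric unfolding metric_connection_def linear_connection_def plus_fun_def by blast+

text \<open>\<open>(\<nabla>\<^sub>x \<phi>) Y\<close> for a field \<open>Y\<close>, as opposed to \<open>cov_phi\<close>, which chooses the field.\<close>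

definition dphi where
  "dphi p x Y = LC p x (\<lambda>q. phi S q (Y q)) - phi S p (LC p x Y)"

lemma dphi_in [simp]: "x \<in> tangent S p \<Longrightarrow> Y \<in> VF \<Longrightarrow> dphi p x Y \<in> tangent S p"
  by (simp add: dphi_def)

text \<open>Differentiate \<open>g(\<phi> Y, Z) = g(Y, \<phi> Z)\<close>. As the right-hand side depends on \<open>Y\<close> through \<open>Y p\<close> only,
  this gives at once the symmetry of \<open>F\<close>, its linearity in the second argument and its
  independence of the chosen extension.\<close>

lemma dphi_symmetric:
  assumes [simp]: "x \<in> tangent S p" "Y \<in> VF" "Z \<in> VF"
  shows "g p (dphi p x Y) (Z p) = g p (Y p) (dphi p x Z)"
proof -
  have "(\<lambda>q. g q (phi S q (Y q)) (Z q)) = (\<lambda>q. g q (Y q) (phi S q (Z q)))"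
    by (simp add: g_phi)
  then show ?thesis
    using LC_metric[of x p "\<lambda>q. phi S q (Y q)" Z] LC_metric[of x p Y "\<lambda>q. phi S q (Z q)"]
    by (simp add: dphi_def lin g_phi)
qed

lemma cov_phi_in [simp]: "x \<in> tangent S p \<Longrightarrow> y \<in> tangent S p \<Longrightarrow> cov_phi S LC p x y \<in> tangent S p"
  using dphi_in[of x p "extension (atlas S) p y"] extension_props[of y p] by (simp add: cov_phi_def dphi_def Let_def)

lemma F_field:
  assumes [simp]: "x \<in> tangent S p" "Y \<in> VF" "z \<in> tangent S p"
  shows "F_tensor S LC p x (Y p) z = g p (dphi p x Y) z"
proof -
  let ?Y = "extension (atlas S) p (Y p)" and ?Z = "extension (atlas S) p z"
  have [simp]: "?Y \<in> VF" "?Z \<in> VF" "?Y p = Y p" "?Z p = z" using extension_props by auto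
  have "F_tensor S LC p x (Y p) z = g p (dphi p x ?Y) (?Z p)"
    by (simp add: F_tensor_def cov_phi_def dphi_def Let_def)
  also have "\<dots> = g p (dphi p x Y) z"
    using dphi_symmetric[of x p ?Y ?Z] dphi_symmetric[of x p Y ?Z] by simp
  finally show ?thesis .
qed

lemma F_sym:
  assumes [simp]: "x \<in> tangent S p" "y \<in> tangent S p" "z \<in> tangent S p"
  shows "F_tensor S LC p x y z = F_tensor S LC p x z y"
proof -
  let ?Y = "extension (atlas S) p y" and ?Z = "extension (atlas S) p z"
  have [simp]: "?Y \<in> VF" "?Z \<in> VF" "?Y p = y" "?Z p = z" using extension_props by auto
  show ?thesis using F_field[of x p ?Y z] F_field[of x p ?Z y] dphi_symmetric[of x p ?Y ?Z]
    by (simp add: g_sym)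
qed

lemma F_linear1:
  assumes [simp]: "y \<in> tangent S p" "z \<in> tangent S p"
  shows "linear_map_on (tangent S p) (\<lambda>x. F_tensor S LC p x y z)"
proof -
  let ?Y = "extension (atlas S) p y"
  have [simp]: "?Y \<in> VF" "?Y p = y" using extension_props by auto
  have "F_tensor S LC p x y z = g p (LC p x (\<lambda>q. phi S q (?Y q)) - phi S p (LC p x ?Y)) z" for x
    by (simp add: F_tensor_def cov_phi_def Let_def)
  then show ?thesis using LC_linear[of ?Y p] LC_linear[of "\<lambda>q. phi S q (?Y q)" p]
    by (simp add: linear_map_on_def lin algebra_simps)
qed

lemma F_linear3:
  "x \<in> tangent S p \<Longrightarrow> y \<in> tangent S p \<Longrightarrow> linear_map_on (tangent S p) (\<lambda>z. F_tensor S LC p x y z)"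
  unfolding F_tensor_def by (rule g_linear) simp

text \<open>The Leibniz rule for \<open>1 = 1 \<cdot> 1\<close>.\<close>

lemma derivation_const:
  assumes "x \<in> tangent S p" shows "x (\<lambda>q. 1) = 0"
proof -
  have "x ((\<lambda>q. 1) * (\<lambda>q. 1)) = 1 * x (\<lambda>q. 1) + 1 * x (\<lambda>q. 1)"
    using assms smooth_const[of 1] unfolding tangent_space_def by blast
  then show ?thesis by (simp add: times_fun_def)
qed

lemma eta_derivative:
  assumes [simp]: "x \<in> tangent S p" "Y \<in> VF"
  shows "x (\<lambda>q. eta S q (Y q)) - eta S p (LC p x Y) = g p (LC p x (xi S)) (Y p)"
  using LC_metric[of x p Y "xi S"] by (simp add: g_xi g_sym[of "Y p"])

lemma dxi_xi: "x \<in> tangent S p \<Longrightarrow> g p (LC p x (xi S)) (xi S p) = 0"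
  using eta_derivative[of x p "xi S"] derivation_const[of x p] by (simp add: g_xi)

text \<open>Differentiate \<open>\<phi>(\<phi> Y) + Y = \<eta>(Y) \<xi>\<close>.\<close>

lemma F_phi:
  assumes [simp]: "x \<in> tangent S p" "y \<in> tangent S p" "z \<in> tangent S p"
  shows "F_tensor S LC p x (phi S p y) z = g p (LC p x (xi S)) y * eta S p z
           + eta S p y * g p (LC p x (xi S)) z - F_tensor S LC p x y (phi S p z)"
proof -
  define Y where "Y = extension (atlas S) p y"
  let ?pY = "\<lambda>q. phi S q (Y q)" and ?e = "\<lambda>q. eta S q (Y q)"
  have [simp]: "Y \<in> VF" "Y p = y" using extension_props by (auto simp: Y_def)
  have "(\<lambda>q. phi S q (?pY q) + Y q) = (\<lambda>q. ?e q *\<^sub>R xi S q)" by (simp add: phi_phi)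
  then have 1: "LC p x (\<lambda>q. phi S q (?pY q)) + LC p x Y = x ?e *\<^sub>R xi S p + eta S p y *\<^sub>R LC p x (xi S)"
    using LC_add[of x p "\<lambda>q. phi S q (?pY q)" Y] LC_scale[of x p ?e "xi S"] by (simp add: eta_smooth)
  have 2: "phi S p (LC p x ?pY) = phi S p (dphi p x Y) - LC p x Y + eta S p (LC p x Y) *\<^sub>R xi S p"
    by (simp add: dphi_def lin phi_phi)
  have "dphi p x ?pY = (x ?e - eta S p (LC p x Y)) *\<^sub>R xi S p + eta S p y *\<^sub>R LC p x (xi S)
      - phi S p (dphi p x Y)"
    unfolding dphi_def[of p x ?pY] 2 using 1 by (simp add: algebra_simps)
  then have "g p (dphi p x ?pY) z = g p (LC p x (xi S)) y * eta S p z
      + eta S p y * g p (LC p x (xi S)) z - g p (dphi p x Y) (phi S p z)"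
    using eta_derivative[of x p Y] by (simp add: lin g_phi g_sym[of "xi S p"] g_xi)
  then show ?thesis using F_field[of x p ?pY z] F_field[of x p Y "phi S p z"] by simp
qed

lemma F_xi_xi:
  assumes [simp]: "x \<in> tangent S p" shows "F_tensor S LC p x (xi S p) (xi S p) = 0"
proof -
  have "LC p x (\<lambda>q. phi S q (xi S q)) = 0"
    using LC_add[of x p "\<lambda>q. phi S q (xi S q)" "\<lambda>q. phi S q (xi S q)"] phi_VF[of "xi S"] by simp
  then show ?thesis using F_field[of x p "xi S" "xi S p"] by (simp add: dphi_def lin g_phi)
qed

text \<open>Both sides equal \<open>g(\<nabla>\<^sub>x \<xi>, y)\<close>.\<close>

lemma cov_eta_F:
  assumes [simp]: "x \<in> tangent S p" "y \<in> tangent S p"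
  shows "cov_eta S LC p x y = F_tensor S LC p x (phi S p y) (xi S p)"
proof -
  let ?Y = "extension (atlas S) p y"
  have [simp]: "?Y \<in> VF" "?Y p = y" using extension_props by auto
  have "F_tensor S LC p x y 0 = 0" using linear_on_tangentD(3)[OF F_linear3] by simp
  then show ?thesis using eta_derivative[of x p ?Y] F_phi[of x p y "xi S p"] dxi_xi[of x p]
    by (simp add: cov_eta_def Let_def)
qed

lemma acb_tensor: "acb_tensor (tangent S p) (phi S p) (xi S p) (eta S p) (F_tensor S LC p)"
proof
  fix x y z assume [simp]: "x \<in> tangent S p" "y \<in> tangent S p" "z \<in> tangent S p"
  note F3 = linear_on_tangentD[OF F_linear3]
  have "F_tensor S LC p x (phi S p w) (xi S p) = g p (LC p x (xi S)) w" if "w \<in> tangent S p" for w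
    using that F_phi[of x p w "xi S p"] dxi_xi[of x p] by (simp add: F3)
  from this[of "phi S p z"] have "g p (LC p x (xi S)) (phi S p z) =
      - F_tensor S LC p x z (xi S p) + eta S p z * F_tensor S LC p x (xi S p) (xi S p)"
    using F_sym[of x p "phi S p (phi S p z)" "xi S p"] F_sym[of x p z "xi S p"]
    by (simp add: F3 phi_phi)
  then show "F_tensor S LC p x (phi S p y) (phi S p z) = F_tensor S LC p x y z
      - eta S p y * F_tensor S LC p x (xi S p) z - eta S p z * F_tensor S LC p x y (xi S p)"
    using F_phi[of x p y "phi S p z"] F_sym[of x p "xi S p" z]
    by (simp add: F3 phi_phi F_xi_xi algebra_simps)
qed (use tangent_space_subspace phi_linear eta_linear F_linear1 F_linear3 F_sym phi_phi in auto)

section \<open>Torsion and classes in terms of \<open>F\<close>\<close>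

lemma nijenhuis_F:
  assumes [simp]: "x \<in> tangent S p" "y \<in> tangent S p" "z \<in> tangent S p"
  shows "nijenhuis S LC p x y z =
    acb_tensor.N (phi S p) (xi S p) (eta S p) (F_tensor S LC p) x y z"
  unfolding nijenhuis_def Let_def acb_tensor.N_def[OF acb_tensor]
  by (simp add: lin g_phi cov_eta_F g_sym[of "xi S p"] g_xi F_tensor_def)

lemma torsion_F:
  assumes "phi_canonical_connection S LC D"
    and [simp]: "x \<in> tangent S p" "y \<in> tangent S p" "z \<in> tangent S p"
  shows "torsion S D p x y z =
    acb_tensor.T (phi S p) (xi S p) (eta S p) (F_tensor S LC p) x y z"
proof -
  have "torsion S D p x y z = dot_torsion S LC p x y z
             - (1/8) * alternate (\<lambda>x y z.
                 nijenhuis S LC p (phi S p (phi S p z)) (phi S p (phi S p y)) (phi S p (phi S p x))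
                 + 2 * nijenhuis S LC p (phi S p z) (phi S p y) (xi S p) * eta S p x) x y z"
    using assms unfolding phi_canonical_connection_def Let_def by blast
  then show ?thesis
    unfolding acb_tensor.T_def[OF acb_tensor] dot_torsion_def Let_def alternate_def
    by (simp add: nijenhuis_F)
qed

lemma torsion_tensors_cong:
  assumes "\<And>x y z. x \<in> tangent S p \<Longrightarrow> y \<in> tangent S p \<Longrightarrow> z \<in> tangent S p \<Longrightarrow> T x y z = T' x y z"
  shows "T \<in> torsion_tensors (tangent S p) \<longleftrightarrow> T' \<in> torsion_tensors (tangent S p)"
  unfolding torsion_tensors_def linear_map_on_def by (simp add: assms)

lemma torsion_T3_iff:
  assumes D: "phi_canonical_connection S LC D"
  shows "torsion S D p \<in> T3_at S p \<longleftrightarrow>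
    acb_tensor.T3 (tangent S p) (phi S p) (xi S p) (eta S p) (F_tensor S LC p)"
proof -
  interpret acb_tensor "tangent S p" "phi S p" "xi S p" "eta S p" "F_tensor S LC p"
    by (rule acb_tensor)
  have "torsion S D p \<in> torsion_tensors (tangent S p)"
    using T_torsion torsion_tensors_cong[of p "torsion S D p" T] torsion_F[OF D] by simp
  then show ?thesis
    unfolding T3_at_def T3_def Let_def by (simp add: torsion_F[OF D] cong: ball_cong)
qed

lemma torsion_T7_iff:
  assumes D: "phi_canonical_connection S LC D"
  shows "torsion S D p \<in> T7_at S p \<longleftrightarrow>
    acb_tensor.T7 (tangent S p) (phi S p) (xi S p) (eta S p) (F_tensor S LC p)"
proof -
  interpret acb_tensor "tangent S p" "phi S p" "xi S p" "eta S p" "F_tensor S LC p"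
    by (rule acb_tensor)
  have "torsion S D p \<in> torsion_tensors (tangent S p)"
    using T_torsion torsion_tensors_cong[of p "torsion S D p" T] torsion_F[OF D] by simp
  then show ?thesis
    unfolding T7_at_def T7_def Let_def by (simp add: torsion_F[OF D] cong: ball_cong)
qed

lemma in_F3_iff:
  "in_F3 S LC \<longleftrightarrow> (\<forall>p. acb_tensor.F3 (tangent S p) (xi S p) (F_tensor S LC p))"
  unfolding in_F3_def acb_tensor.F3_def[OF acb_tensor] Let_def by simp

lemma in_F7_iff:
  "in_F7 n S LC \<longleftrightarrow> (\<forall>p. acb_tensor.F7 (tangent S p) (phi S p) (xi S p) (eta S p) (F_tensor S LC p))"
  (is "_ \<longleftrightarrow> ?R")
proof
  show "in_F7 n S LC \<Longrightarrow> ?R"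
    unfolding in_F7_def acb_tensor.F7_def[OF acb_tensor] Let_def by blast
  assume R: ?R
  have "theta n S LC p e h z = 0 \<and> theta_star n S LC p e h z = 0"
    if e: "is_basis (2 * n) e (contact_kernel S p)" and h: "inverse_gram (2 * n) (g p) e h"
      and z: "z \<in> tangent S p" for p e h z
  proof -
    interpret acb_tensor "tangent S p" "phi S p" "xi S p" "eta S p" "F_tensor S LC p"
      by (rule acb_tensor)
    have "e ` {..<2 * n} \<subseteq> contact_kernel S p"
      using e span_superset unfolding is_basis_def by metis
    then have e_in: "e i \<in> tangent S p \<and> eta S p (e i) = 0" if "i < 2 * n" for i
      using that by (auto simp: contact_kernel_def)
    have sym: "h i j = h j i" if "i < 2 * n" "j < 2 * n" for i j
      by (rule inverse_gram_sym[OF h _ that]) (use e_in g_sym in blast)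
    show ?thesis
      using F7_traces[of "2 * n" e h z] R e_in sym z unfolding theta_def theta_star_def by blast
  qed
  then show "in_F7 n S LC"
    using R unfolding in_F7_def acb_tensor.F7_def[OF acb_tensor] Let_def by blast
qed

end

section \<open>The correspondence of classes\<close>

theorem corollary3p9:
  fixes S :: "('m::{t2_space, second_countable_topology}, 'e::euclidean_space) acbm"
    and n :: nat
    and LC D :: "'m connection"
  assumes "almost_contact_B_metric_manifold n S"
    and "levi_civita_connection S LC"
    and "phi_canonical_connection S LC D"
  shows "((\<forall>p. torsion S D p \<in> T3_at S p) \<longleftrightarrow> in_F3 S LC) \<and>
         ((\<forall>p. torsion S D p \<in> T7_at S p) \<longleftrightarrow> in_F7 n S LC)"
proof -
  interpret acb_manifold S n LC
    using assms by unfold_locales (auto simp: levi_civita_connection_def)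
  show ?thesis
    unfolding torsion_T3_iff[OF assms(3)] torsion_T7_iff[OF assms(3)] in_F3_iff in_F7_iff
    using acb_tensor.F3_imp_T3[OF acb_tensor] acb_tensor.T3_imp_F3[OF acb_tensor]
      acb_tensor.F7_imp_T7[OF acb_tensor] acb_tensor.T7_imp_F7[OF acb_tensor] by blast
qed

end
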